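(* Consider the bivariate scale model with order restriction $\theta_1\le\theta_2$, scaled squared error loss for estimating $\theta_2$, and, for a fixed $\beta>0$, the class $\mathcal{D}_{2,\beta}=\{\delta_\alpha:\alpha\in\mathbb{R}\}$ of estimators of $\theta_2$, with $c_{0,2}$, $f_Z$, $\psi_4$, $\psi^*$, $k_2$, $\alpha_2(\cdot)$ all as defined in the context. Put $\alpha_{2,1}=\alpha_2(1)$ and $\alpha_{2,\infty}=\lim_{\lambda\to\infty}\alpha_2(\lambda)\in[-\infty,\infty]$. (a) Suppose that $\psi^*$ is decreasing on $(0,\frac{\beta}{c_{0,2}})$ and that one of the following holds: (i) for every fixed $\theta\in(0,1)$, $t\mapsto\frac{\psi_4(\theta t)}{\psi_4(t)}$ and $t\mapsto\frac{f_Z(\theta t)}{f_Z(t)}$ are increasing on $(0,\frac{\beta}{c_{0,2}})$, and, for every $\lambda\ge1$, $z\mapsto k_2(z,\lambda)$ is increasing on $(0,1)$; or (ii) for every fixed $\theta\in(0,1)$, these two ratios are decreasing in $t$ on $(0,\frac{\beta}{c_{0,2}})$, and, for every $\lambda\ge1$, $z\mapsto k_2(z,\lambda)$ is decreasing on $(0,1)$. Then the estimators that are admissible within the class $\mathcal{D}_{2,\beta}$ are exactly those $\delta_\alpha$ with $\alpha\in\mathbb{R}$, $\alpha_{2,1}\le\alpha\le\alpha_{2,\infty}$. Moreover, if $-\infty<a<b\le\alpha_{2,1}$ or $\alpha_{2,\infty}\le b<a<\infty$, then $\delta_b$ dominates $\delta_a$, i.e. $R_2(\underline\theta,\delta_b)\le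 R_2(\underline\theta,\delta_a)$ for all $\underline\theta\in\Theta_0$. (b) Suppose that $\psi^*$ is increasing on $(0,\frac{\beta}{c_{0,2}})$ and that one of the following holds: (i) for every fixed $\theta\in(0,1)$, $t\mapsto\frac{\psi_4(\theta t)}{\psi_4(t)}$ and $t\mapsto\frac{f_Z(\theta t)}{f_Z(t)}$ are increasing on $(0,\frac{\beta}{c_{0,2}})$, and, for every $\lambda\ge1$, $z\mapsto k_2(z,\lambda)$ is decreasing on $(0,1)$; or (ii) for every fixed $\theta\in(0,1)$, these two ratios are decreasing in $t$ on $(0,\frac{\beta}{c_{0,2}})$, and, for every $\lambda\ge1$, $z\mapsto k_2(z,\lambda)$ is increasing on $(0,1)$. Then the estimators that are admissible within the class $\mathcal{D}_{2,\beta}$ are exactly those $\delta_\alpha$ with $\alpha\in\mathbb{R}$, $\alpha_{2,\infty}\le\alpha\le\alpha_{2,1}$. Moreover, if $-\infty<a<b\le\alpha_{2,\infty}$ or $\alpha_{2,1}\le b<a<\infty$, then $\delta_b$ dominates $\delta_a$, i.e. $R_2(\underline\theta,\delta_b)\le R_2(\underline\theta,\delta_a)$ for all $\underline\theta\in\Theta_0$.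
   Context: Model: $f$ is a fixed Lebesgue probability density supported in $(0,\infty)^2$ and $\underline X=(X_1,X_2)$ has density $\frac{1}{\theta_1\theta_2}f\left(\frac{x_1}{\theta_1},\frac{x_2}{\theta_2}\right)$ with unknown $\underline\theta=(\theta_1,\theta_2)\in\Theta_0=\{(t_1,t_2)\in(0,\infty)^2:t_1\le t_2\}$. Put $\lambda=\theta_2/\theta_1\ge1$, $Z_i=X_i/\theta_i$ ($i=1,2$), $Z=Z_2/Z_1$; the pair $(Z_1,Z_2)$ has density $f$ whatever $\underline\theta$ is. It is assumed that $E[Z_1^2],E[Z_2^2]<\infty$. $c_{0,2}=E[Z_2]/E[Z_2^2]$ (so $c_{0,2}X_2$ is the best scale equivariant estimator of $\theta_2$). $\beta>0$ is a fixed constant. Estimators: for $\alpha\in\mathbb{R}$, $$\delta_\alpha(\underline X)=\begin{cases}c_{0,2}X_2,&\text{if }\beta X_1\le c_{0,2}X_2,\\ \alpha\beta X_1+(1-\alpha)c_{0,2}X_2,&\text{if }\beta X_1>c_{0,2}X_2,\end{cases}$$ and $\mathcal{D}_{2,\beta}=\{\delta_\alpha:\alpha\in\mathbb{R}\}$. Risk: $R_2(\underline\theta,\delta)=E_{\underline\theta}\left[\left(\frac{\delta(\underline X)}{\theta_2}-1\right)^2\right]$, $\underline\theta\in\Theta_0$. An estimator $\delta\in\mathcal{D}_{2,\beta}$ is admissible within $\mathcal{D}_{2,\beta}$ if there is no $\delta'\in\mathcal{D}_{2,\beta}$ with $R_2(\underline\theta,\delta')\le R_2(\underline\theta,\delta)$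 for all $\underline\theta\in\Theta_0$ and strict inequality for some $\underline\theta\in\Theta_0$. Functions: $f_Z(z)=\int_0^\infty s f(s,sz)\,ds$, $z>0$, is the density of $Z$; for $r=1,2$, $\psi_r(z)=E[Z_1^r\mid Z=z]=\int_0^\infty s^{r+1}f(s,sz)\,ds\,/\,\int_0^\infty s f(s,sz)\,ds$; $\psi_3(z)=E[Z_2\mid Z=z]=z\psi_1(z)$; $\psi_4(z)=E[Z_2^2\mid Z=z]=z^2\psi_2(z)$; $\psi^*(z)=\psi_3(z)/\psi_4(z)$. It is assumed that $0<f_Z(z)<\infty$ and that these functions are well defined (finite) for all $z\in(0,\frac{\beta}{c_{0,2}})$. For $0<z<1$, $\lambda\ge1$, $$k_2(z,\lambda)=\frac{\psi^*\left(\frac{\beta z}{\lambda c_{0,2}}\right)-c_{0,2}}{\frac1z-1}.$$ For $\lambda\ge1$, $$\alpha_2(\lambda)=\frac{1}{c_{0,2}}\,\frac{\int_0^1\left(\frac1t-1\right)\left(\psi^*\left(\frac{\beta t}{\lambda c_{0,2}}\right)-c_{0,2}\right)\psi_4\left(\frac{\beta t}{\lambda c_{0,2}}\right)f_Z\left(\frac{\beta t}{\lambda c_{0,2}}\right)dt}{\int_0^1\left(\frac1t-1\right)^2\psi_4\left(\frac{\beta t}{\lambda c_{0,2}}\right)f_Z\left(\frac{\beta t}{\lambda c_{0,2}}\right)dt}.$$ "Increasing" means non-decreasing and "decreasing" means non-increasing. *)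

theory Defs
  imports "HOL-Analysis.Analysis" "HOL-Probability.Probability"
begin

text \<open>The density of \<open>(Z\<^sub>1, Z\<^sub>2)\<close> is \<open>f\<close>; vectors in the plane are pairs. The model is represented by
  the family of laws of \<open>X = (\<theta>\<^sub>1 Z\<^sub>1, \<theta>\<^sub>2 Z\<^sub>2)\<close>, on which alone risks depend.\<close>

definition scale_model :: "(real \<times> real \<Rightarrow> real) \<Rightarrow> real \<times> real \<Rightarrow> (real \<times> real) measure" where
  "scale_model f \<theta> = density lborel
     (\<lambda>x. ennreal (1 / (fst \<theta> * snd \<theta>) * f (fst x / fst \<theta>, snd x / snd \<theta>)))"

definition Theta0 :: "(real \<times> real) set" where
  "Theta0 = {(t1, t2). 0 < t1 \<and> 0 < t2 \<and> t1 \<le> t2}"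

definition risk2 :: "(real \<times> real \<Rightarrow> real) \<Rightarrow> real \<times> real \<Rightarrow> (real \<times> real \<Rightarrow> real) \<Rightarrow> real" where
  "risk2 f \<theta> d = (LINT x|scale_model f \<theta>. (d x / snd \<theta> - 1)\<^sup>2)"

definition c02 :: "(real \<times> real \<Rightarrow> real) \<Rightarrow> real" where
  "c02 f = (LINT z|density lborel (\<lambda>z. ennreal (f z)). snd z) /
           (LINT z|density lborel (\<lambda>z. ennreal (f z)). (snd z)\<^sup>2)"

definition estimator :: "(real \<times> real \<Rightarrow> real) \<Rightarrow> real \<Rightarrow> real \<Rightarrow> real \<times> real \<Rightarrow> real" where
  "estimator f \<beta> \<alpha> x =
     (if \<beta> * fst x \<le> c02 f * snd x then c02 f * snd x
      else \<alpha> * \<beta> * fst x + (1 - \<alpha>) * c02 f * snd x)"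

definition D2 :: "(real \<times> real \<Rightarrow> real) \<Rightarrow> real \<Rightarrow> (real \<times> real \<Rightarrow> real) set" where
  "D2 f \<beta> = range (estimator f \<beta>)"

definition admissible_within ::
    "(real \<times> real \<Rightarrow> real) \<Rightarrow> (real \<times> real \<Rightarrow> real) set \<Rightarrow> (real \<times> real \<Rightarrow> real) \<Rightarrow> bool" where
  "admissible_within f D d \<longleftrightarrow> d \<in> D \<and>
     \<not> (\<exists>d'\<in>D. (\<forall>\<theta>\<in>Theta0. risk2 f \<theta> d' \<le> risk2 f \<theta> d) \<and>
                 (\<exists>\<theta>\<in>Theta0. risk2 f \<theta> d' < risk2 f \<theta> d))"

definition dominates ::
    "(real \<times> real \<Rightarrow> real) \<Rightarrow> (real \<times> real \<Rightarrow> real) \<Rightarrow> (real \<times> real \<Rightarrow> real) \<Rightarrow> bool" where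
  "dominates f d' d \<longleftrightarrow> (\<forall>\<theta>\<in>Theta0. risk2 f \<theta> d' \<le> risk2 f \<theta> d)"

text \<open>\<open>fZ f\<close> is the density of \<open>Z = Z\<^sub>2 / Z\<^sub>1\<close>. For \<open>r = 1, 2\<close>, \<open>psi f r z\<close> is \<open>E[Z\<^sub>1\<^sup>r | Z = z]\<close>;
  \<open>psi3\<close> and \<open>psi4\<close> are the conditional first and second moments of \<open>Z\<^sub>2 = Z Z\<^sub>1\<close>.\<close>

definition fZ :: "(real \<times> real \<Rightarrow> real) \<Rightarrow> real \<Rightarrow> real" where
  "fZ f z = (LINT s:{0<..}|lborel. s * f (s, s * z))"

definition psi :: "(real \<times> real \<Rightarrow> real) \<Rightarrow> nat \<Rightarrow> real \<Rightarrow> real" where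
  "psi f r z = (LINT s:{0<..}|lborel. s ^ (r + 1) * f (s, s * z)) /
               (LINT s:{0<..}|lborel. s * f (s, s * z))"

definition psi3 :: "(real \<times> real \<Rightarrow> real) \<Rightarrow> real \<Rightarrow> real" where
  "psi3 f z = z * psi f 1 z"

definition psi4 :: "(real \<times> real \<Rightarrow> real) \<Rightarrow> real \<Rightarrow> real" where
  "psi4 f z = z\<^sup>2 * psi f 2 z"

definition psi_star :: "(real \<times> real \<Rightarrow> real) \<Rightarrow> real \<Rightarrow> real" where
  "psi_star f z = psi3 f z / psi4 f z"

definition k2 :: "(real \<times> real \<Rightarrow> real) \<Rightarrow> real \<Rightarrow> real \<Rightarrow> real \<Rightarrow> real" where
  "k2 f \<beta> z l = (psi_star f (\<beta> * z / (l * c02 f)) - c02 f) / (1 / z - 1)"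

definition alpha2 :: "(real \<times> real \<Rightarrow> real) \<Rightarrow> real \<Rightarrow> real \<Rightarrow> real" where
  "alpha2 f \<beta> l = 1 / c02 f *
     ((LINT t:{0<..<1}|lborel. (1 / t - 1) * (psi_star f (\<beta> * t / (l * c02 f)) - c02 f) *
         psi4 f (\<beta> * t / (l * c02 f)) * fZ f (\<beta> * t / (l * c02 f))) /
      (LINT t:{0<..<1}|lborel. (1 / t - 1)\<^sup>2 *
         psi4 f (\<beta> * t / (l * c02 f)) * fZ f (\<beta> * t / (l * c02 f))))"

text \<open>\<open>Lim\<close> is a definite description, hence unspecified if the limit does not exist; statements
  about \<open>alpha2_inf\<close> therefore assert convergence separately.\<close>

definition alpha2_inf :: "(real \<times> real \<Rightarrow> real) \<Rightarrow> real \<Rightarrow> ereal" where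
  "alpha2_inf f \<beta> = Lim at_top (\<lambda>l. ereal (alpha2 f \<beta> l))"

definition ratio_increasing_on :: "real set \<Rightarrow> (real \<Rightarrow> real) \<Rightarrow> bool" where
  "ratio_increasing_on A g \<longleftrightarrow> (\<forall>\<theta>\<in>{0<..<1}. mono_on A (\<lambda>t. g (\<theta> * t) / g t))"

definition ratio_decreasing_on :: "real set \<Rightarrow> (real \<Rightarrow> real) \<Rightarrow> bool" where
  "ratio_decreasing_on A g \<longleftrightarrow> (\<forall>\<theta>\<in>{0<..<1}. antimono_on A (\<lambda>t. g (\<theta> * t) / g t))"

end

theory Submission
  imports Defs
begin

text \<open>
  Write \<open>c\<close> for \<open>c02 f\<close>, \<open>v = \<beta> / (\<lambda> c)\<close> and \<open>V = max 0 (v Z\<^sub>1 - Z\<^sub>2)\<close>. The scaled error of \<open>\<delta>\<^sub>\<alpha>\<close> is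
  \<open>c Z\<^sub>2 - 1 + \<alpha> c V\<close>, so the risk is a quadratic polynomial in \<open>\<alpha>\<close> with leading coefficient
  \<open>c\<^sup>2 E[V\<^sup>2] > 0\<close>; in the coordinates \<open>(s, z) = (Z\<^sub>1, Z\<^sub>2 / Z\<^sub>1)\<close> its minimiser turns out to be \<open>\<alpha>\<^sub>2(\<lambda>)\<close>.
  Moreover \<open>c \<alpha>\<^sub>2(\<lambda>)\<close> is the mean of \<open>k\<^sub>2(\<cdot>, \<lambda>)\<close> under a weight on \<open>(0, 1)\<close>. Increasing \<open>\<lambda>\<close> changes
  the weight by a monotone factor, which Chebyshev's inequality controls, and changes \<open>k\<^sub>2\<close> pointwise
  according to the monotonicity of \<open>\<psi>\<^sup>*\<close>; both effects have the same sign, so \<open>\<alpha>\<^sub>2\<close> is monotone.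
  Admissibility then only depends on how \<open>\<alpha>\<close> compares with the values of \<open>\<alpha>\<^sub>2\<close>: neither continuity of
  \<open>\<alpha>\<^sub>2\<close> nor attainment of its limit is needed.
\<close>

section \<open>Changes of variables and Chebyshev's inequality\<close>

text \<open>For fixed s > 0 the substitution y = s z stretches Lebesgue measure by s, which is the
  Jacobian of (s, z) \<mapsto> (s, s z); Tonelli then handles s. As an identity of measures it
  transfers integrability as well as the values of integrals.\<close>

lemma distr_shear:
  "distr (density lborel (\<lambda>x. indicator {0<..} (fst x) * ennreal (fst x))) borel
      (\<lambda>x. (fst x, fst x * snd x)) =
   density lborel (\<lambda>x::real \<times> real. indicator {0<..} (fst x))" (is "?L = ?R")
proof (rule measure_eqI)
  show "sets ?L = sets ?R" by simp
next
  fix A :: "(real \<times> real) set" assume "A \<in> sets ?L"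
  then have [measurable]: "A \<in> sets (borel \<Otimes>\<^sub>M borel)" and A: "A \<in> sets borel"
    unfolding borel_prod by simp_all
  have "emeasure ?L A = (\<integral>\<^sup>+x. indicator A x \<partial>?L)"
    using A by simp
  also have "\<dots> = (\<integral>\<^sup>+x. indicator {0<..} (fst x) * ennreal (fst x) *
      indicator A (fst x, fst x * snd x) \<partial>(lborel \<Otimes>\<^sub>M lborel))"
    using A unfolding lborel_prod[symmetric] borel_prod[symmetric]
    by (subst nn_integral_distr, simp_all)+ (subst nn_integral_density, simp_all)
  also have "\<dots> = (\<integral>\<^sup>+s. \<integral>\<^sup>+z. indicator {0<..} s * ennreal s * indicator A (s, s * z) \<partial>lborel \<partial>lborel)"
    by (subst lborel.nn_integral_fst[symmetric]) simp_all
  also have "\<dots> = (\<integral>\<^sup>+s. \<integral>\<^sup>+y. indicator {0<..} s * indicator A (s, y) \<partial>lborel \<partial>lborel)"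
  proof (rule nn_integral_cong)
    fix s :: real
    show "(\<integral>\<^sup>+z. indicator {0<..} s * ennreal s * indicator A (s, s * z) \<partial>lborel) =
        (\<integral>\<^sup>+y. indicator {0<..} s * indicator A (s, y) \<partial>lborel)"
    proof (cases "0 < s")
      case True
      have "(\<integral>\<^sup>+y. indicator A (s, y) \<partial>lborel) = ennreal s * (\<integral>\<^sup>+z. indicator A (s, s * z) \<partial>lborel)"
        using True by (subst nn_integral_real_affine[where c = s and t = 0]) auto
      with True show ?thesis by (simp add: nn_integral_cmult)
    qed simp
  qed
  also have "\<dots> = (\<integral>\<^sup>+x. indicator {0<..} (fst x) * indicator A x \<partial>(lborel \<Otimes>\<^sub>M lborel))"
    by (subst lborel.nn_integral_fst[symmetric]) simp_all
  also have "\<dots> = emeasure ?R A"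
    using A by (simp add: lborel_prod[symmetric] emeasure_density)
  finally show "emeasure ?L A = emeasure ?R A" .
qed

text \<open>The substitutions in the two coordinates produce the factors \<theta>1 and \<theta>2,
  which cancel the normalisation of the density. Every risk thereby becomes an integral against the
  single law of (Z1, Z2), with \<theta> moved into the integrand.\<close>

lemma scale_model_eq_distr:
  assumes [measurable]: "f \<in> borel_measurable borel" and pos: "0 < fst \<theta>" "0 < snd \<theta>"
  shows "scale_model f \<theta> = distr (density lborel (\<lambda>z. ennreal (f z))) borel
    (\<lambda>z. (fst \<theta> * fst z, snd \<theta> * snd z))" (is "?L = ?R")
proof (rule measure_eqI)
  show "sets ?L = sets ?R" by (simp add: scale_model_def)
next
  fix A :: "(real \<times> real) set" assume "A \<in> sets ?L"
  then have [measurable]: "A \<in> sets (borel \<Otimes>\<^sub>M borel)" and A: "A \<in> sets borel"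
    unfolding borel_prod by (simp_all add: scale_model_def)
  have [measurable]: "f \<in> borel_measurable (borel \<Otimes>\<^sub>M borel)" by (simp add: borel_prod)
  obtain a b where [simp]: "\<theta> = (a, b)" by force
  from pos have [simp]: "0 < a" "0 < b" "0 \<le> a" "0 \<le> b" "a \<noteq> 0" "b \<noteq> 0" by auto
  have "emeasure ?L A = (\<integral>\<^sup>+x. ennreal (1 / (a * b) * f (fst x / a, snd x / b)) *
      indicator A x \<partial>(lborel \<Otimes>\<^sub>M lborel))"
    unfolding scale_model_def using A by (simp add: lborel_prod[symmetric] emeasure_density)
  also have "\<dots> = (\<integral>\<^sup>+x. \<integral>\<^sup>+y. ennreal (1 / (a * b) * f (x / a, y / b)) *
      indicator A (x, y) \<partial>lborel \<partial>lborel)"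
    by (subst lborel.nn_integral_fst[symmetric]) simp_all
  also have "\<dots> = (\<integral>\<^sup>+x. ennreal b * (\<integral>\<^sup>+y. ennreal (1 / (a * b) * f (x / a, y)) *
      indicator A (x, b * y) \<partial>lborel) \<partial>lborel)"
  proof (intro nn_integral_cong)
    fix x
    show "(\<integral>\<^sup>+y. ennreal (1 / (a * b) * f (x / a, y / b)) * indicator A (x, y) \<partial>lborel) =
        ennreal b * (\<integral>\<^sup>+y. ennreal (1 / (a * b) * f (x / a, y)) * indicator A (x, b * y) \<partial>lborel)"
      by (subst nn_integral_real_affine[where c = b and t = 0]) simp_all
  qed
  also have "\<dots> = ennreal a * (\<integral>\<^sup>+x. ennreal b * (\<integral>\<^sup>+y. ennreal (1 / (a * b) * f (x, y)) *
      indicator A (a * x, b * y) \<partial>lborel) \<partial>lborel)"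
    by (subst nn_integral_real_affine[where c = a and t = 0]) simp_all
  also have "\<dots> = (\<integral>\<^sup>+x. \<integral>\<^sup>+y. ennreal a * (ennreal b * (ennreal (1 / (a * b) * f (x, y)) *
      indicator A (a * x, b * y))) \<partial>lborel \<partial>lborel)"
    by (simp add: nn_integral_cmult)
  also have "\<dots> = (\<integral>\<^sup>+x. \<integral>\<^sup>+y. ennreal (f (x, y)) * indicator A (a * x, b * y) \<partial>lborel \<partial>lborel)"
    by (intro nn_integral_cong)
      (simp add: mult.assoc[symmetric] ennreal_mult'[symmetric])
  also have "\<dots> = (\<integral>\<^sup>+x. ennreal (f x) * indicator A (a * fst x, b * snd x) \<partial>(lborel \<Otimes>\<^sub>M lborel))"
    by (subst lborel.nn_integral_fst[symmetric]) simp_all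
  also have "\<dots> = (\<integral>\<^sup>+x. indicator A x \<partial>?R)"
    using A unfolding lborel_prod[symmetric] borel_prod[symmetric]
    by (subst nn_integral_distr, simp_all)+ (subst nn_integral_density, simp_all)
  also have "\<dots> = emeasure ?R A" using A by simp
  finally show "emeasure ?L A = emeasure ?R A" .
qed

text \<open>Similar ordering of \<open>k\<close> and \<open>q / p\<close> is stated with denominators cleared, so that it is symmetric in
  the two weights up to sign and needs no positivity.\<close>

lemma weighted_chebyshev:
  fixes k p q :: "'a \<Rightarrow> real"
  assumes p: "set_integrable M A p" and q: "set_integrable M A q"
    and kp: "set_integrable M A (\<lambda>t. k t * p t)" and kq: "set_integrable M A (\<lambda>t. k t * q t)"
    and similarly_ordered:
      "\<And>s t. s \<in> A \<Longrightarrow> t \<in> A \<Longrightarrow> 0 \<le> (k s - k t) * (q s * p t - q t * p s)"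
  shows "(LINT t:A|M. k t * p t) * (LINT t:A|M. q t) \<le> (LINT t:A|M. k t * q t) * (LINT t:A|M. p t)"
proof -
  let ?P = "LINT t:A|M. p t" and ?Q = "LINT t:A|M. q t"
  let ?KP = "LINT t:A|M. k t * p t" and ?KQ = "LINT t:A|M. k t * q t"
  \<comment> \<open>The ordering hypothesis, expanded, is integrated in s for fixed t and then in t.
    Only linearity of single integrals is used, so no product measure enters; the final value is
    twice the difference of the two sides.\<close>
  have inner: "0 \<le> ?KQ * p t - ?KP * q t - (k t * p t) * ?Q + (k t * q t) * ?P" if t: "t \<in> A" for t
  proof -
    have "0 \<le> (LINT s:A|M. (k s * q s) * p t - (k s * p s) * q t - (k t * p t) * q s + (k t * q t) * p s)"
      unfolding set_lebesgue_integral_def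
      using similarly_ordered[OF _ t]
      by (intro integral_nonneg_AE AE_I2) (auto simp: indicator_def algebra_simps)
    also have "\<dots> = ?KQ * p t - ?KP * q t - (k t * p t) * ?Q + (k t * q t) * ?P"
      using p q kp kq by simp
    finally show ?thesis .
  qed
  have "0 \<le> (LINT t:A|M. ?KQ * p t - ?KP * q t - (k t * p t) * ?Q + (k t * q t) * ?P)"
    unfolding set_lebesgue_integral_def[of _ A "\<lambda>t. ?KQ * p t - ?KP * q t - (k t * p t) * ?Q + (k t * q t) * ?P"]
    using inner
    by (intro integral_nonneg_AE AE_I2) (auto simp: indicator_def)
  also have "\<dots> = ?KQ * ?P - ?KP * ?Q - ?KP * ?Q + ?KQ * ?P"
    using p q kp kq by simp
  finally show ?thesis by (simp add: mult.commute)
qed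

section \<open>Estimators with quadratic risk\<close>

text \<open>The supremum over the tail \<open>{l0..}\<close> is the limit, and in the extended reals
  it always exists. Monotonicity from \<open>l0\<close> on is enough, which matters because
  \<open>alpha2\<close> is only controlled for \<lambda> \<ge> 1.\<close>

lemma nondecreasing_tendsto_Lim:
  fixes a :: "real \<Rightarrow> ereal"
  assumes mono: "\<And>l l'. l0 \<le> l \<Longrightarrow> l \<le> l' \<Longrightarrow> a l \<le> a l'"
  shows "(a \<longlongrightarrow> Lim at_top a) at_top"
proof -
  have "(a \<longlongrightarrow> (SUP l\<in>{l0..}. a l)) at_top"
  proof (rule order_tendstoI)
    fix y assume "y < (SUP l\<in>{l0..}. a l)"
    then obtain l where l: "l0 \<le> l" "y < a l" by (auto simp: less_SUP_iff)
    show "\<forall>\<^sub>F l in at_top. y < a l"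
      using eventually_ge_at_top[of l] by eventually_elim (use l mono in \<open>meson less_le_trans\<close>)
  next
    fix y assume y: "(SUP l\<in>{l0..}. a l) < y"
    show "\<forall>\<^sub>F l in at_top. a l < y"
      using eventually_ge_at_top[of l0]
      by eventually_elim (rule le_less_trans[OF SUP_upper y], simp)
  qed
  then show ?thesis by (simp add: tendsto_Lim)
qed

lemma nonincreasing_tendsto_Lim:
  fixes a :: "real \<Rightarrow> ereal"
  assumes anti: "\<And>l l'. l0 \<le> l \<Longrightarrow> l \<le> l' \<Longrightarrow> a l' \<le> a l"
  shows "(a \<longlongrightarrow> Lim at_top a) at_top"
proof -
  have "((\<lambda>l. - a l) \<longlongrightarrow> Lim at_top (\<lambda>l. - a l)) at_top"
    using anti by (intro nondecreasing_tendsto_Lim[of l0]) simp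
  then have "((\<lambda>l. - (- a l)) \<longlongrightarrow> - Lim at_top (\<lambda>l. - a l)) at_top"
    by (rule tendsto_uminus_ereal)
  then have "(a \<longlongrightarrow> - Lim at_top (\<lambda>l. - a l)) at_top" by simp
  then show ?thesis by (simp add: tendsto_Lim)
qed

text \<open>At each parameter the risk is a strictly increasing function of the distance from
  \<alpha> to \<open>a l\<close>, with l the parameter ratio, so risks compare as these distances
  do. All the targets \<open>a l\<close> lie between \<open>a 1\<close> and L. From outside this
  interval, moving towards it shortens every distance. From inside, the target \<open>a 1\<close>
  forbids moving up and targets close to L forbid moving down.\<close>

lemma
  fixes a :: "real \<Rightarrow> real" and L :: ereal
  assumes risk: "\<And>\<theta>. \<theta> \<in> Theta0 \<Longrightarrow>
      \<exists>R D. 0 < D \<and> (\<forall>\<alpha>. risk2 f \<theta> (e \<alpha>) = R + D * (\<alpha> - a (snd \<theta> / fst \<theta>))\<^sup>2)"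
    and mono: "\<And>l l'. 1 \<le> l \<Longrightarrow> l \<le> l' \<Longrightarrow> a l \<le> a l'"
    and lim: "((\<lambda>l. ereal (a l)) \<longlongrightarrow> L) at_top"
  shows admissible_nondecreasing: "{d. admissible_within f (range e) d} =
      {e \<alpha> |\<alpha>. ereal (a 1) \<le> ereal \<alpha> \<and> ereal \<alpha> \<le> L}"
    and dominates_nondecreasing:
      "(x < y \<and> y \<le> a 1) \<or> (L \<le> ereal y \<and> y < x) \<Longrightarrow> dominates f (e y) (e x)"
proof -
  have upper: "ereal (a l) \<le> L" if "1 \<le> l" for l
    using eventually_mono[OF eventually_ge_at_top[of l] mono[OF that]]
    by (intro tendsto_lowerbound[OF lim]) simp_all
  have ratio: "1 \<le> snd \<theta> / fst \<theta>" if "\<theta> \<in> Theta0" for \<theta>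
    using that by (auto simp: Theta0_def)
  have risk_le: "risk2 f \<theta> (e \<alpha>) \<le> risk2 f \<theta> (e \<alpha>') \<longleftrightarrow>
      \<bar>\<alpha> - a (snd \<theta> / fst \<theta>)\<bar> \<le> \<bar>\<alpha>' - a (snd \<theta> / fst \<theta>)\<bar>" if \<theta>: "\<theta> \<in> Theta0" for \<theta> \<alpha> \<alpha>'
  proof -
    obtain R D where "0 < D" "\<And>\<alpha>. risk2 f \<theta> (e \<alpha>) = R + D * (\<alpha> - a (snd \<theta> / fst \<theta>))\<^sup>2"
      using risk[OF \<theta>] by blast
    then show ?thesis by (simp add: abs_le_square_iff)
  qed
  have point: "(1, l) \<in> Theta0" if "1 \<le> l" for l using that by (simp add: Theta0_def)
  have not_adm: "\<not> admissible_within f (range e) (e \<alpha>)"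
    if "\<And>l. 1 \<le> l \<Longrightarrow> \<bar>\<alpha>' - a l\<bar> < \<bar>\<alpha> - a l\<bar>" for \<alpha> \<alpha>'
  proof -
    have "risk2 f \<theta> (e \<alpha>') < risk2 f \<theta> (e \<alpha>)" if "\<theta> \<in> Theta0" for \<theta>
      using \<open>\<And>l. 1 \<le> l \<Longrightarrow> \<bar>\<alpha>' - a l\<bar> < \<bar>\<alpha> - a l\<bar>\<close>[OF ratio[OF that]]
        risk_le[OF that, of \<alpha> \<alpha>'] by simp
    then show ?thesis
      using point[of 1] unfolding admissible_within_def by (metis less_imp_le order_refl rangeI)
  qed
  show "dominates f (e y) (e x)" if "(x < y \<and> y \<le> a 1) \<or> (L \<le> ereal y \<and> y < x)"
    unfolding dominates_def
  proof
    fix \<theta> assume \<theta>: "\<theta> \<in> Theta0"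
    let ?l = "snd \<theta> / fst \<theta>"
    have "a 1 \<le> a ?l" "ereal (a ?l) \<le> L" using mono[OF order_refl ratio] upper ratio \<theta> by auto
    then have "a 1 \<le> a ?l" "L \<le> ereal y \<Longrightarrow> a ?l \<le> y" by (auto dest: order_trans)
    then show "risk2 f \<theta> (e y) \<le> risk2 f \<theta> (e x)"
      unfolding risk_le[OF \<theta>] using that by auto
  qed
  have adm_imp: "ereal (a 1) \<le> ereal \<alpha> \<and> ereal \<alpha> \<le> L" if adm: "admissible_within f (range e) (e \<alpha>)" for \<alpha>
  proof (rule ccontr)
    assume "\<not> ?thesis"
    then consider "\<alpha> < a 1" | "L < ereal \<alpha>" by force
    then show False
    proof cases
      case 1
      have "\<bar>a 1 - a l\<bar> < \<bar>\<alpha> - a l\<bar>" if "1 \<le> l" for l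
        using 1 mono[OF order_refl that] by auto
      with not_adm adm show False by blast
    next
      \<comment> \<open>L is a real number here: it is at least \<open>a 1\<close> and lies below
        \<alpha>. Hence the estimator with parameter L belongs to the class and serves as the
        competitor.\<close>
      case 2
      with upper[of 1] obtain m where m: "L = ereal m" by (cases L) auto
      have "\<bar>m - a l\<bar> < \<bar>\<alpha> - a l\<bar>" if "1 \<le> l" for l
        using 2 upper[OF that] m by auto
      with not_adm adm show False by blast
    qed
  qed
  have imp_adm: "admissible_within f (range e) (e \<alpha>)"
    if lo: "a 1 \<le> \<alpha>" and up: "ereal \<alpha> \<le> L" for \<alpha>
    unfolding admissible_within_def
  proof (safe intro!: rangeI)
    fix \<alpha>' t1 t2
    assume dom: "\<forall>\<theta>\<in>Theta0. risk2 f \<theta> (e \<alpha>') \<le> risk2 f \<theta> (e \<alpha>)"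
      and strict: "risk2 f (t1, t2) (e \<alpha>') < risk2 f (t1, t2) (e \<alpha>)"
    have le: "\<bar>\<alpha>' - a l\<bar> \<le> \<bar>\<alpha> - a l\<bar>" if "1 \<le> l" for l
      using bspec[OF dom point[OF that]] risk_le[OF point[OF that]] by simp
    from strict have "\<alpha>' \<noteq> \<alpha>" by auto
    moreover have "\<alpha>' \<le> \<alpha>" using le[of 1] lo by simp
    ultimately have "\<alpha>' < \<alpha>" by simp
    \<comment> \<open>A target beyond the midpoint of \<alpha>' and \<alpha> is strictly closer to
      \<alpha>. Since the midpoint lies strictly below L, convergence supplies such a target even if
      L itself is never attained.\<close>
    then have "ereal ((\<alpha> + \<alpha>') / 2) < ereal \<alpha>" by simp
    with up have "ereal ((\<alpha> + \<alpha>') / 2) < L" by (rule less_le_trans[rotated])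
    then have "\<forall>\<^sub>F l in at_top. ereal ((\<alpha> + \<alpha>') / 2) < ereal (a l) \<and> 1 \<le> l"
      using order_tendstoD(1)[OF lim] eventually_ge_at_top by (intro eventually_conj)
    then obtain l where "(\<alpha> + \<alpha>') / 2 < a l" "1 \<le> l"
      by (auto dest!: eventually_happens)
    with le[of l] \<open>\<alpha>' < \<alpha>\<close> show False by (auto simp: abs_le_iff abs_if split: if_splits)
  qed
  show "{d. admissible_within f (range e) d} = {e \<alpha> |\<alpha>. ereal (a 1) \<le> ereal \<alpha> \<and> ereal \<alpha> \<le> L}"
  proof (intro set_eqI iffI)
    fix d assume "d \<in> {d. admissible_within f (range e) d}"
    then show "d \<in> {e \<alpha> |\<alpha>. ereal (a 1) \<le> ereal \<alpha> \<and> ereal \<alpha> \<le> L}"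
      using adm_imp unfolding admissible_within_def by blast
  qed (use imp_adm in auto)
qed

text \<open>Reflecting the parameter, \<alpha> \<mapsto> -\<alpha>, leaves the class of estimators
  unchanged, turns the minimiser into \<open>- a l\<close> and reverses the order, so the
  nondecreasing case applies with limit -L.\<close>

lemma
  fixes a :: "real \<Rightarrow> real" and L :: ereal
  assumes risk: "\<And>\<theta>. \<theta> \<in> Theta0 \<Longrightarrow>
      \<exists>R D. 0 < D \<and> (\<forall>\<alpha>. risk2 f \<theta> (e \<alpha>) = R + D * (\<alpha> - a (snd \<theta> / fst \<theta>))\<^sup>2)"
    and anti: "\<And>l l'. 1 \<le> l \<Longrightarrow> l \<le> l' \<Longrightarrow> a l' \<le> a l"
    and lim: "((\<lambda>l. ereal (a l)) \<longlongrightarrow> L) at_top"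
  shows admissible_nonincreasing: "{d. admissible_within f (range e) d} =
      {e \<alpha> |\<alpha>. L \<le> ereal \<alpha> \<and> ereal \<alpha> \<le> ereal (a 1)}"
    and dominates_nonincreasing:
      "(x < y \<and> ereal y \<le> L) \<or> (a 1 \<le> y \<and> y < x) \<Longrightarrow> dominates f (e y) (e x)"
proof -
  let ?e = "\<lambda>\<alpha>. e (- \<alpha>)" and ?a = "\<lambda>l. - a l"
  have sq: "(- \<alpha> - a l)\<^sup>2 = (\<alpha> - ?a l)\<^sup>2" for \<alpha> l
    by (metis minus_diff_minus minus_minus power2_commute power2_minus)
  have risk': "\<exists>R D. 0 < D \<and> (\<forall>\<alpha>. risk2 f \<theta> (?e \<alpha>) = R + D * (\<alpha> - ?a (snd \<theta> / fst \<theta>))\<^sup>2)"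
    if "\<theta> \<in> Theta0" for \<theta>
    using risk[OF that] unfolding sq[symmetric] by blast
  have mono': "?a l \<le> ?a l'" if "1 \<le> l" "l \<le> l'" for l l' using anti[OF that] by simp
  have lim': "((\<lambda>l. ereal (?a l)) \<longlongrightarrow> - L) at_top"
    using tendsto_uminus_ereal[OF lim] by simp
  have range: "range ?e = range e"
    by (auto simp: image_iff) (metis minus_minus)
  have set_eq: "{?e \<alpha> |\<alpha>. ereal (?a 1) \<le> ereal \<alpha> \<and> ereal \<alpha> \<le> - L} =
      {e \<alpha> |\<alpha>. L \<le> ereal \<alpha> \<and> ereal \<alpha> \<le> ereal (a 1)}" (is "?A = ?B")
  proof (intro set_eqI iffI)
    fix d assume "d \<in> ?A"
    then obtain \<alpha> where "d = e (- \<alpha>)" "- a 1 \<le> \<alpha>" "ereal \<alpha> \<le> - L" by auto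
    moreover from this have "L \<le> ereal (- \<alpha>)" by (cases L) auto
    ultimately show "d \<in> ?B" by (auto intro!: exI[of _ "- \<alpha>"])
  next
    fix d assume "d \<in> ?B"
    then obtain \<alpha> where "d = e \<alpha>" "\<alpha> \<le> a 1" "L \<le> ereal \<alpha>" by auto
    moreover from this have "ereal (- \<alpha>) \<le> - L" by (cases L) auto
    ultimately show "d \<in> ?A" by (auto intro!: exI[of _ "- \<alpha>"])
  qed
  show "{d. admissible_within f (range e) d} = ?B"
    using admissible_nondecreasing[of f ?e ?a "- L", OF risk' mono' lim'] unfolding range set_eq .
  show "dominates f (e y) (e x)" if "(x < y \<and> ereal y \<le> L) \<or> (a 1 \<le> y \<and> y < x)"
  proof -
    have "(- x < - y \<and> - y \<le> ?a 1) \<or> (- L \<le> ereal (- y) \<and> - y < - x)"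
      using that by (cases L) auto
    from dominates_nondecreasing[of f ?e ?a "- L", OF risk' mono' lim' this] show ?thesis by simp
  qed
qed

section \<open>Polar form of the moments\<close>

text \<open>The unnormalised conditional moment E[Z1^r | Z = z] f_Z(z). The extra power of s is the
  Jacobian of (s, z) \<mapsto> (s, s z).\<close>

definition radial_moment :: "(real \<times> real \<Rightarrow> real) \<Rightarrow> nat \<Rightarrow> real \<Rightarrow> real" where
  "radial_moment f r z = (LINT s:{0<..}|lborel. s ^ (r + 1) * f (s, s * z))"

lemma radial_moment_measurable [measurable]:
  assumes "f \<in> borel_measurable borel"
  shows "radial_moment f r \<in> borel_measurable borel"
proof -
  have [measurable]: "f \<in> borel_measurable (borel \<Otimes>\<^sub>M borel)" using assms by (simp add: borel_prod)
  show ?thesis unfolding radial_moment_def[abs_def] set_lebesgue_integral_def by measurable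
qed

lemma fZ_eq_radial_moment: "fZ f z = radial_moment f 0 z"
  by (simp add: fZ_def radial_moment_def)

lemma psi_eq_radial_moment: "psi f r z = radial_moment f r z / radial_moment f 0 z"
  by (simp add: psi_def radial_moment_def)

section \<open>The law of (Z1, Z2): positivity and moments\<close>

locale scale_density =
  fixes f :: "real \<times> real \<Rightarrow> real" and \<beta> :: real
  assumes f_measurable [measurable]: "f \<in> borel_measurable borel"
    and f_nonneg: "\<And>x. 0 \<le> f x"
    and f_prob: "prob_space (density lborel (\<lambda>z. ennreal (f z)))"
    and f_support: "\<And>x. x \<notin> {0<..} \<times> {0<..} \<Longrightarrow> f x = 0"
    and moment1: "integrable (density lborel (\<lambda>z. ennreal (f z))) (\<lambda>z. (fst z)\<^sup>2)"
    and moment2: "integrable (density lborel (\<lambda>z. ennreal (f z))) (\<lambda>z. (snd z)\<^sup>2)"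
    and beta_pos: "0 < \<beta>"
    and well_defined: "\<And>z r. z \<in> {0<..<\<beta> / c02 f} \<Longrightarrow> r \<in> {0, 1, 2::nat} \<Longrightarrow>
           set_integrable lborel {0<..} (\<lambda>s. s ^ (r + 1) * f (s, s * z))"
    and fZ_pos: "\<And>z. z \<in> {0<..<\<beta> / c02 f} \<Longrightarrow> 0 < fZ f z"
begin

abbreviation c :: real where "c \<equiv> c02 f"
abbreviation P :: "(real \<times> real) measure" where "P \<equiv> density lborel (\<lambda>z. ennreal (f z))"

sublocale P: prob_space P by (rule f_prob)

lemma f_measurable_pair [measurable]: "f \<in> borel_measurable (borel \<Otimes>\<^sub>M borel)"
  by (simp add: borel_prod)

lemma fst_borel [measurable]: "(fst :: real \<times> real \<Rightarrow> real) \<in> borel_measurable borel"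
  and snd_borel [measurable]: "(snd :: real \<times> real \<Rightarrow> real) \<in> borel_measurable borel"
  unfolding borel_prod[symmetric] by simp_all

lemma AE_positive: "AE x in P. 0 < fst x \<and> 0 < snd x"
proof -
  have "0 < fst x \<and> 0 < snd x" if "f x \<noteq> 0" for x
    using f_support[of x] that by (cases x) auto
  then show ?thesis by (subst AE_density) auto
qed

lemma integrable_fst: "integrable P fst"
  by (rule P.square_integrable_imp_integrable[OF _ moment1]) measurable

lemma integrable_snd: "integrable P snd"
  by (rule P.square_integrable_imp_integrable[OF _ moment2]) measurable

lemma integrable_fst_snd: "integrable P (\<lambda>x. fst x * snd x)"
proof (rule Bochner_Integration.integrable_bound[OF Bochner_Integration.integrable_add[OF moment1 moment2]])
  have "\<bar>x * y\<bar> \<le> x\<^sup>2 + y\<^sup>2" for x y :: real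
    using sum_squares_bound[of "\<bar>x\<bar>" "\<bar>y\<bar>"] mult_nonneg_nonneg[of "\<bar>x\<bar>" "\<bar>y\<bar>"]
    unfolding abs_mult power2_abs by linarith
  then show "AE x in P. norm (fst x * snd x) \<le> norm ((fst x)\<^sup>2 + (snd x)\<^sup>2)"
    by (intro AE_I2) (metis abs_ge_self order_trans real_norm_def)
qed measurable

text \<open>Z2 is almost surely positive, and a nonnegative integrand with zero integral would
  vanish almost surely; so both moments in the quotient are positive.\<close>

lemma c_pos: "0 < c"
proof -
  have pos: "0 < (LINT x|P. g x)" if g: "integrable P g" and "\<And>x. 0 < snd x \<Longrightarrow> 0 < g x"
    for g :: "real \<times> real \<Rightarrow> real"
  proof -
    have ae: "AE x in P. 0 < g x" using AE_positive that by auto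
    then have nn: "AE x in P. 0 \<le> g x" by auto
    have "(LINT x|P. g x) \<noteq> 0"
    proof
      assume "(LINT x|P. g x) = 0"
      then have "AE x in P. g x = 0" using integral_nonneg_eq_0_iff_AE[OF g nn] by simp
      with ae have "AE x in P. False" by eventually_elim simp
      then show False by simp
    qed
    moreover have "0 \<le> (LINT x|P. g x)" using nn by (rule integral_nonneg_AE)
    ultimately show ?thesis by simp
  qed
  show ?thesis
    unfolding c02_def using pos[OF integrable_snd] pos[OF moment2] by simp
qed

text \<open>In the coordinates (s, z) the integrand separates into h(z) and a function whose
  integral over s is the radial moment, the Jacobian raising s^r to s^(r+1). Fubini then integrates
  out s.\<close>

lemma
  assumes [measurable]: "h \<in> borel_measurable borel"
    and int: "integrable P (\<lambda>x. fst x ^ r * h (snd x / fst x))"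
  shows integrable_radial: "integrable lborel (\<lambda>z. h z * radial_moment f r z)"
    and integral_radial:
      "(LINT x|P. fst x ^ r * h (snd x / fst x)) = (LINT z|lborel. h z * radial_moment f r z)"
proof -
  define G where "G x = f x * (fst x ^ r * h (snd x / fst x))" for x :: "real \<times> real"
  define K where "K s z = indicator {0<..} s * (s ^ (r + 1) * f (s, s * z)) * h z" for s z :: real
  have [measurable]: "G \<in> borel_measurable borel"
    unfolding G_def[abs_def] by measurable
  \<comment> \<open>As f vanishes off the positive quadrant, Lebesgue measure may be replaced by its
    restriction to s > 0, the measure that \<open>distr_shear\<close> describes.\<close>
  have G_support: "G x = indicator {0<..} (fst x) * G x" for x
    using f_support[of x] by (cases x) (auto simp: G_def indicator_def)
  let ?Q = "density lborel (\<lambda>x. indicator {0<..} (fst x) * ennreal (fst x))"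
  have Q: "?Q = density lborel (\<lambda>x. ennreal (indicator {0<..} (fst x) * fst x))"
    by (intro arg_cong[where f = "density lborel"] ext) (auto simp: indicator_def)
  have KG: "indicator {0<..} (fst x) * fst x * G (fst x, fst x * snd x) = K (fst x) (snd x)" for x
    by (auto simp: K_def G_def indicator_def)
  have nonneg: "0 \<le> indicator {0<..} a * a" for a :: real by (simp add: indicator_def)
  have R: "density lborel (\<lambda>x::real \<times> real. indicator {0<..} (fst x)) =
      density lborel (\<lambda>x::real \<times> real. ennreal (indicator {0<..} (fst x)))"
    by (intro arg_cong[where f = "density lborel"] ext) (simp add: indicator_def)
  have [measurable]: "(\<lambda>x::real \<times> real. (fst x, fst x * snd x)) \<in> borel_measurable borel"
    unfolding borel_prod[symmetric] by measurable
  have [measurable]: "(\<lambda>x::real \<times> real. indicator {0<..} (fst x) :: real) \<in> borel_measurable borel"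
    unfolding borel_prod[symmetric] by measurable
  have "integrable lborel G"
    using int f_nonneg by (simp add: integrable_density G_def[abs_def])
  then have "integrable (density lborel (\<lambda>x. indicator {0<..} (fst x))) G"
    unfolding R by (subst integrable_density) (simp_all add: G_support[symmetric])
  then have "integrable ?Q (\<lambda>x. G (fst x, fst x * snd x))"
    unfolding distr_shear[symmetric] by (subst (asm) integrable_distr_eq) simp_all
  then have K: "integrable (lborel \<Otimes>\<^sub>M lborel) (\<lambda>(s, z). K s z)"
    unfolding Q by (subst (asm) integrable_density)
      (simp_all add: KG lborel_prod case_prod_beta' nonneg)
  have inner: "(LINT s|lborel. K s z) = h z * radial_moment f r z" for z
    unfolding K_def radial_moment_def set_lebesgue_integral_def by simp
  show "integrable lborel (\<lambda>z. h z * radial_moment f r z)"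
    using lborel_pair.integrable_snd[OF K] by (simp add: inner)
  have "(LINT x|P. fst x ^ r * h (snd x / fst x)) = (LINT x|lborel. G x)"
    using f_nonneg by (subst integral_density) (simp_all add: G_def[abs_def])
  also have "\<dots> = (LINT x|density lborel (\<lambda>x. indicator {0<..} (fst x)). G x)"
    unfolding R by (subst integral_density) (simp_all add: G_support[symmetric])
  also have "\<dots> = (LINT x|?Q. G (fst x, fst x * snd x))"
    unfolding distr_shear[symmetric] by (subst integral_distr) simp_all
  also have "\<dots> = (LINT x|(lborel \<Otimes>\<^sub>M lborel). (\<lambda>(s, z). K s z) x)"
    unfolding Q by (subst integral_density)
      (simp_all add: KG lborel_prod case_prod_beta' nonneg)
  also have "\<dots> = (LINT z|lborel. h z * radial_moment f r z)"
    using lborel_pair.integral_snd[OF K] by (simp add: inner)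
  finally show "(LINT x|P. fst x ^ r * h (snd x / fst x)) = \<dots>" .
qed

text \<open>The substitution z = v t carries (0, v) to (0, 1) and contributes the factor v. The
  polar form of g is required only on the positive quadrant, which has full probability.\<close>

lemma
  assumes [measurable]: "q \<in> borel_measurable borel" and v: "0 < v"
    and g [measurable]: "g \<in> borel_measurable borel" and int: "integrable P g"
    and g_eq: "\<And>x. 0 < fst x \<Longrightarrow> 0 < snd x \<Longrightarrow>
      g x = fst x ^ r * (indicator {0<..<v} (snd x / fst x) * q (snd x / fst x))"
  shows set_integrable_radial:
      "set_integrable lborel {0<..<1} (\<lambda>t. q (v * t) * radial_moment f r (v * t))"
    and set_integral_radial:
      "(LINT x|P. g x) = v * (LINT t:{0<..<1}|lborel. q (v * t) * radial_moment f r (v * t))"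
proof -
  define h where "h z = indicator {0<..<v} z * q z" for z :: real
  have [measurable]: "h \<in> borel_measurable borel" unfolding h_def[abs_def] by measurable
  have ae: "AE x in P. g x = fst x ^ r * h (snd x / fst x)"
    using AE_positive by eventually_elim (simp add: g_eq h_def)
  have int_h: "integrable P (\<lambda>x. fst x ^ r * h (snd x / fst x))"
    using int by (subst (asm) integrable_cong_AE[OF _ _ ae]) simp_all
  have h: "h (v * t) = indicator {0<..<1} t * q (v * t)" for t
    using v by (auto simp: h_def indicator_def zero_less_mult_iff)
  have "integrable lborel (\<lambda>t. h (v * t) * radial_moment f r (v * t))"
    using lborel_integrable_real_affine[OF integrable_radial[OF _ int_h], of v 0] v by simp
  then show "set_integrable lborel {0<..<1} (\<lambda>t. q (v * t) * radial_moment f r (v * t))"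
    unfolding set_integrable_def by (simp add: h mult.assoc)
  have "(LINT x|P. g x) = (LINT x|P. fst x ^ r * h (snd x / fst x))"
    using ae by (intro integral_cong_AE) simp_all
  also have "\<dots> = (LINT z|lborel. h z * radial_moment f r z)"
    by (rule integral_radial[OF _ int_h]) simp
  also have "\<dots> = v * (LINT t|lborel. h (v * t) * radial_moment f r (v * t))"
    using v by (subst lborel_integral_real_affine[of v _ 0]) simp_all
  finally show "(LINT x|P. g x) = v * (LINT t:{0<..<1}|lborel. q (v * t) * radial_moment f r (v * t))"
    unfolding set_lebesgue_integral_def by (simp add: h mult.assoc)
qed

section \<open>The minimiser of the risk as a weighted mean\<close>

text \<open>With v = \<beta> / (\<lambda> c) this is the integrand in the denominator of
  \<open>alpha2\<close>, and \<open>excess\<close> is then \<open>k2\<close>. Keeping v free lets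
  the excess at one \<lambda> be paired with the weight at another.\<close>

definition weight :: "real \<Rightarrow> real \<Rightarrow> real" where
  "weight v t = (1 / t - 1)\<^sup>2 * psi4 f (v * t) * fZ f (v * t)"

definition excess :: "real \<Rightarrow> real \<Rightarrow> real" where
  "excess v t = (psi_star f (v * t) - c) / (1 / t - 1)"

definition overshoot :: "real \<Rightarrow> real \<times> real \<Rightarrow> real" where
  "overshoot v x = max 0 (v * fst x - snd x)"

lemma overshoot_measurable [measurable]: "overshoot v \<in> borel_measurable borel"
  unfolding overshoot_def[abs_def] by measurable

lemma radial_moment_0_pos: "z \<in> {0<..<\<beta> / c} \<Longrightarrow> 0 < radial_moment f 0 z"
  using fZ_pos by (simp add: fZ_eq_radial_moment)

lemma radial_moment_nonneg: "0 \<le> radial_moment f r z"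
  unfolding radial_moment_def set_lebesgue_integral_def
  by (intro integral_nonneg_AE AE_I2) (auto simp: indicator_def f_nonneg)

text \<open>If the integral of s^3 f(s, s z) over s > 0 were zero, f(s, s z) would vanish for almost
  every s > 0, and f_Z(z) would be zero as well.\<close>

lemma radial_moment_2_pos:
  assumes z: "z \<in> {0<..<\<beta> / c}"
  shows "0 < radial_moment f 2 z"
proof -
  have "radial_moment f 2 z \<noteq> 0"
  proof
    assume "radial_moment f 2 z = 0"
    then have "(LINT s|lborel. indicator {0<..} s * (s ^ 3 * f (s, s * z))) = 0"
      unfolding radial_moment_def set_lebesgue_integral_def by simp
    moreover have "integrable lborel (\<lambda>s. indicator {0<..} s * (s ^ 3 * f (s, s * z)))"
      using well_defined[OF z, of 2] unfolding set_integrable_def by simp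
    ultimately have "AE s in lborel. indicator {0<..} s * (s ^ 3 * f (s, s * z)) = 0"
      by (subst (asm) integral_nonneg_eq_0_iff_AE) (auto simp: indicator_def f_nonneg)
    then have "AE s in lborel. indicator {0<..} s *\<^sub>R (s ^ (0 + 1) * f (s, s * z)) = 0"
      by eventually_elim (auto simp: indicator_def)
    then have "radial_moment f 0 z = 0"
      unfolding radial_moment_def set_lebesgue_integral_def by (rule integral_eq_zero_AE)
    with radial_moment_0_pos[OF z] show False by simp
  qed
  with radial_moment_nonneg[of 2 z] show ?thesis by simp
qed

lemma psi_star_eq:
  assumes "z \<in> {0<..<\<beta> / c}"
  shows "psi_star f z = radial_moment f 1 z / (z * radial_moment f 2 z)"
  using radial_moment_0_pos[OF assms] assms
  by (simp add: psi_star_def psi3_def psi4_def psi_eq_radial_moment power2_eq_square)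

lemma psi4_fZ_eq:
  assumes "z \<in> {0<..<\<beta> / c}"
  shows "psi4 f z * fZ f z = z\<^sup>2 * radial_moment f 2 z"
  using radial_moment_0_pos[OF assms]
  by (simp add: psi4_def psi_eq_radial_moment fZ_eq_radial_moment)

lemma psi_star_nonneg: "z \<in> {0<..<\<beta> / c} \<Longrightarrow> 0 \<le> psi_star f z"
  by (simp add: psi_star_eq radial_moment_nonneg)

lemma psi4_pos: "z \<in> {0<..<\<beta> / c} \<Longrightarrow> 0 < psi4 f z"
  using radial_moment_0_pos radial_moment_2_pos by (simp add: psi4_def psi_eq_radial_moment)

text \<open>At \<lambda> = 1 the scale v equals the endpoint \<beta> / c; strictness of t < 1 still
  puts the argument inside the open interval where the hypotheses hold.\<close>

lemma scaled_in:
  assumes "v \<in> {0<..\<beta> / c}" "t \<in> {0<..<1}" shows "v * t \<in> {0<..<\<beta> / c}"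
proof -
  have "v * t < v * 1" using assms by (intro mult_strict_left_mono) auto
  also have "v * 1 \<le> \<beta> / c" using assms by simp
  finally show ?thesis using assms by simp
qed

text \<open>The factor v t contributed by \<open>psi4\<close> absorbs the pole of 1/t - 1, since
  (1/t - 1) v t = v - v t. What remains is the integrand of E[V^2] in polar form, where V = Z1
  max(0, v - Z).\<close>

lemma weight_eq:
  assumes "v \<in> {0<..\<beta> / c}" "t \<in> {0<..<1}"
  shows "weight v t = (v - v * t)\<^sup>2 * radial_moment f 2 (v * t)"
proof -
  have "weight v t = (1 / t - 1)\<^sup>2 * ((v * t)\<^sup>2 * radial_moment f 2 (v * t))"
    unfolding weight_def psi4_fZ_eq[OF scaled_in[OF assms], symmetric] by simp
  also have "\<dots> = ((1 / t - 1) * (v * t))\<^sup>2 * radial_moment f 2 (v * t)"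
    by (simp add: power_mult_distrib)
  also have "(1 / t - 1) * (v * t) = v - v * t" using assms by (simp add: field_simps)
  finally show ?thesis .
qed

lemma weight_pos: "v \<in> {0<..\<beta> / c} \<Longrightarrow> t \<in> {0<..<1} \<Longrightarrow> 0 < weight v t"
  using radial_moment_2_pos[OF scaled_in] by (simp add: weight_eq)

lemma excess_weight:
  assumes "t \<in> {0<..<1}"
  shows "excess u t * weight v t =
    (1 / t - 1) * (psi_star f (u * t) - c) * psi4 f (v * t) * fZ f (v * t)"
proof -
  have "1 / t - 1 \<noteq> 0" using assms by simp
  then show ?thesis by (simp add: excess_def weight_def power2_eq_square)
qed

text \<open>The same cancellation as in \<open>weight_eq\<close>; it yields the integrand of E[V],
  and \<open>const_weight\<close> yields that of E[V Z2].\<close>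

lemma psi_star_weight:
  assumes "v \<in> {0<..\<beta> / c}" "t \<in> {0<..<1}"
  shows "(1 / t - 1) * psi_star f (v * t) * psi4 f (v * t) * fZ f (v * t) =
    (v - v * t) * radial_moment f 1 (v * t)"
proof -
  let ?z = "v * t"
  have z: "?z \<in> {0<..<\<beta> / c}" by (rule scaled_in[OF assms])
  have "(1 / t - 1) * psi_star f ?z * psi4 f ?z * fZ f ?z =
      (1 / t - 1) * psi_star f ?z * (?z\<^sup>2 * radial_moment f 2 ?z)"
    unfolding psi4_fZ_eq[OF z, symmetric] by simp
  also have "\<dots> = (1 / t - 1) * ?z * radial_moment f 1 ?z"
    using z radial_moment_2_pos[OF z] unfolding psi_star_eq[OF z] power2_eq_square by auto
  also have "(1 / t - 1) * ?z = v - v * t" using assms by (simp add: field_simps)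
  finally show ?thesis .
qed

lemma const_weight:
  assumes "v \<in> {0<..\<beta> / c}" "t \<in> {0<..<1}"
  shows "(1 / t - 1) * psi4 f (v * t) * fZ f (v * t) =
    (v - v * t) * (v * t) * radial_moment f 2 (v * t)"
proof -
  let ?z = "v * t"
  have z: "?z \<in> {0<..<\<beta> / c}" by (rule scaled_in[OF assms])
  have "(1 / t - 1) * psi4 f ?z * fZ f ?z = (1 / t - 1) * (?z\<^sup>2 * radial_moment f 2 ?z)"
    unfolding psi4_fZ_eq[OF z, symmetric] by simp
  also have "\<dots> = ((1 / t - 1) * ?z) * ?z * radial_moment f 2 ?z"
    by (simp add: power2_eq_square)
  also have "(1 / t - 1) * ?z = v - v * t" using assms by (simp add: field_simps)
  finally show ?thesis .
qed

context
  fixes v assumes v: "v \<in> {0<..\<beta> / c}"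
begin

text \<open>Almost surely 0 \<le> V \<le> v Z1, so second moments of Z1 and Z2 dominate all three
  integrands.\<close>

lemma
  shows integrable_overshoot: "integrable P (overshoot v)"
    and integrable_overshoot_snd: "integrable P (\<lambda>x. overshoot v x * snd x)"
    and integrable_overshoot_sq: "integrable P (\<lambda>x. (overshoot v x)\<^sup>2)"
proof -
  have bound: "0 \<le> overshoot v x \<and> overshoot v x \<le> v * fst x" if "0 < fst x \<and> 0 < snd x" for x
    using that v by (auto simp: overshoot_def)
  show "integrable P (overshoot v)"
  proof (rule Bochner_Integration.integrable_bound)
    show "integrable P (\<lambda>x. v * fst x)" using integrable_fst by simp
    show "AE x in P. norm (overshoot v x) \<le> norm (v * fst x)"
      using AE_positive by eventually_elim (use bound in force)
  qed measurable
  show "integrable P (\<lambda>x. overshoot v x * snd x)"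
  proof (rule Bochner_Integration.integrable_bound)
    show "integrable P (\<lambda>x. v * (fst x * snd x))" using integrable_fst_snd by simp
    have le: "norm (overshoot v x * snd x) \<le> norm (v * (fst x * snd x))" if "0 < fst x \<and> 0 < snd x" for x
      using bound[OF that] that v by (auto simp: abs_mult mult.assoc[symmetric])
    show "AE x in P. norm (overshoot v x * snd x) \<le> norm (v * (fst x * snd x))"
      using AE_positive by eventually_elim (rule le)
  qed measurable
  show "integrable P (\<lambda>x. (overshoot v x)\<^sup>2)"
  proof (rule Bochner_Integration.integrable_bound)
    show "integrable P (\<lambda>x. v\<^sup>2 * (fst x)\<^sup>2)" using moment1 by simp
    have le: "norm ((overshoot v x)\<^sup>2) \<le> norm (v\<^sup>2 * (fst x)\<^sup>2)" if "0 < fst x \<and> 0 < snd x" for x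
      using power_mono[of "overshoot v x" "v * fst x" 2] bound[OF that]
      by (simp add: power_mult_distrib)
    show "AE x in P. norm ((overshoot v x)\<^sup>2) \<le> norm (v\<^sup>2 * (fst x)\<^sup>2)"
      using AE_positive by eventually_elim (rule le)
  qed measurable
qed

lemma overshoot_polar:
  assumes "0 < fst x" "0 < snd x"
  shows "overshoot v x = fst x * (indicator {0<..<v} (snd x / fst x) * (v - snd x / fst x))"
  using assms by (auto simp: overshoot_def indicator_def field_simps max_def)

text \<open>V is homogeneous of degree one in (Z1, Z2), so V, V Z2 and V^2 are Z1^r times a function
  of Z with r = 1, 2, 2. Their expectations are v times the integrals from which
  \<open>alpha2\<close> is built.\<close>

lemma
  shows set_integrable_psi_star_weight: "set_integrable lborel {0<..<1}
      (\<lambda>t. (1 / t - 1) * psi_star f (v * t) * psi4 f (v * t) * fZ f (v * t))" (is ?I1)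
    and set_integral_psi_star_weight: "(LINT x|P. overshoot v x) = v * (LINT t:{0<..<1}|lborel.
      (1 / t - 1) * psi_star f (v * t) * psi4 f (v * t) * fZ f (v * t))" (is ?E1)
    and set_integrable_const_weight: "set_integrable lborel {0<..<1}
      (\<lambda>t. (1 / t - 1) * psi4 f (v * t) * fZ f (v * t))" (is ?I2)
    and set_integral_const_weight: "(LINT x|P. overshoot v x * snd x) = v * (LINT t:{0<..<1}|lborel.
      (1 / t - 1) * psi4 f (v * t) * fZ f (v * t))" (is ?E2)
    and set_integrable_weight: "set_integrable lborel {0<..<1} (weight v)" (is ?I3)
    and set_integral_weight:
      "(LINT x|P. (overshoot v x)\<^sup>2) = v * (LINT t:{0<..<1}|lborel. weight v t)" (is ?E3)
proof -
  have v0: "0 < v" using v by simp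
  note cong = set_integrable_cong[OF refl refl, THEN iffD2]
    set_lebesgue_integral_cong[of "{0<..<1::real}" lborel]
  have eq1: "overshoot v x = fst x ^ 1 * (indicator {0<..<v} (snd x / fst x) * (v - snd x / fst x))"
    if "0 < fst x" "0 < snd x" for x
    using overshoot_polar[OF that] by simp
  have eq2: "overshoot v x * snd x =
      fst x ^ 2 * (indicator {0<..<v} (snd x / fst x) * ((v - snd x / fst x) * (snd x / fst x)))"
    if "0 < fst x" "0 < snd x" for x
    using that unfolding overshoot_polar[OF that] by (simp add: power2_eq_square)
  have eq3: "(overshoot v x)\<^sup>2 =
      fst x ^ 2 * (indicator {0<..<v} (snd x / fst x) * (v - snd x / fst x)\<^sup>2)"
    if "0 < fst x" "0 < snd x" for x
    unfolding overshoot_polar[OF that] by (simp add: power_mult_distrib indicator_def)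
  have m1: "(\<lambda>z. v - z) \<in> borel_measurable borel" "(\<lambda>z. (v - z) * z) \<in> borel_measurable borel"
    "(\<lambda>z. (v - z)\<^sup>2) \<in> borel_measurable borel" by measurable
  have m2: "overshoot v \<in> borel_measurable borel" "(\<lambda>x. overshoot v x * snd x) \<in> borel_measurable borel"
    "(\<lambda>x. (overshoot v x)\<^sup>2) \<in> borel_measurable borel" by measurable
  note args1 = m1(1) v0 m2(1) integrable_overshoot eq1
  note args2 = m1(2) v0 m2(2) integrable_overshoot_snd eq2
  note args3 = m1(3) v0 m2(3) integrable_overshoot_sq eq3
  show ?I1 by (rule cong(1)[OF _ set_integrable_radial[OF args1]]) (rule psi_star_weight[OF v])
  show ?E1 by (subst set_integral_radial[OF args1], assumption+)
      (intro arg_cong[where f = "(*) v"] cong(2), auto simp: psi_star_weight[OF v])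
  show ?I2 by (rule cong(1)[OF _ set_integrable_radial[OF args2]]) (rule const_weight[OF v])
  show ?E2 by (subst set_integral_radial[OF args2], assumption+)
      (intro arg_cong[where f = "(*) v"] cong(2), auto simp: const_weight[OF v])
  show ?I3 by (rule cong(1)[OF _ set_integrable_radial[OF args3]]) (rule weight_eq[OF v])
  show ?E3 by (subst set_integral_radial[OF args3], assumption+)
      (intro arg_cong[where f = "(*) v"] cong(2), auto simp: weight_eq[OF v])
qed

lemma set_integral_weight_pos: "0 < (LINT t:{0<..<1}|lborel. weight v t)"
proof -
  have int: "integrable lborel (\<lambda>t. indicator {0<..<1} t * weight v t)"
    using set_integrable_weight unfolding set_integrable_def by simp
  have nn: "AE t in lborel. 0 \<le> indicator {0<..<1} t * weight v t"
    using weight_pos[OF v] by (intro AE_I2) (auto simp: indicator_def less_imp_le)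
  have "(LINT t|lborel. indicator {0<..<1} t * weight v t) \<noteq> 0"
  proof
    assume "(LINT t|lborel. indicator {0<..<1} t * weight v t) = 0"
    then have "AE t in lborel. indicator {0<..<1} t * weight v t = 0"
      using integral_nonneg_eq_0_iff_AE[OF int nn] by simp
    then have "AE t in lborel. t \<notin> {0<..<1::real}"
      by eventually_elim (use weight_pos[OF v] in \<open>force simp: indicator_def\<close>)
    then have "emeasure lborel {0<..<1::real} = 0"
      by (subst (asm) AE_iff_measurable[where N = "{0<..<1::real}"]) auto
    then show False by simp
  qed
  moreover have "0 \<le> (LINT t|lborel. indicator {0<..<1} t * weight v t)"
    using nn by (rule integral_nonneg_AE)
  ultimately show ?thesis unfolding set_lebesgue_integral_def by simp
qed

text \<open>The numerator of \<open>alpha2\<close> splits into a \<open>psi_star\<close> part and a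
  constant part, each separately integrable. The left-hand side is what the linear coefficient of
  the risk in \<alpha> contains, up to the factor -2c.\<close>

lemma
  shows set_integrable_excess_weight:
      "set_integrable lborel {0<..<1} (\<lambda>t. excess v t * weight v t)"
    and set_integral_excess_weight:
      "(LINT x|P. overshoot v x) - c * (LINT x|P. overshoot v x * snd x) =
       v * (LINT t:{0<..<1}|lborel. excess v t * weight v t)"
proof -
  have eq: "excess v t * weight v t = (1 / t - 1) * psi_star f (v * t) * psi4 f (v * t) * fZ f (v * t)
      - c * ((1 / t - 1) * psi4 f (v * t) * fZ f (v * t))" if "t \<in> {0<..<1}" for t
    unfolding excess_weight[OF that] by (simp add: algebra_simps)
  show "set_integrable lborel {0<..<1} (\<lambda>t. excess v t * weight v t)"
    by (subst set_integrable_cong[OF refl refl eq])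
      (use set_integrable_psi_star_weight set_integrable_const_weight in auto)
  have "(LINT t:{0<..<1}|lborel. excess v t * weight v t) =
      (LINT t:{0<..<1}|lborel. (1 / t - 1) * psi_star f (v * t) * psi4 f (v * t) * fZ f (v * t)
      - c * ((1 / t - 1) * psi4 f (v * t) * fZ f (v * t)))"
    by (rule set_lebesgue_integral_cong) (auto simp: eq)
  also have "\<dots> = (LINT t:{0<..<1}|lborel. (1 / t - 1) * psi_star f (v * t) * psi4 f (v * t) * fZ f (v * t))
      - c * (LINT t:{0<..<1}|lborel. (1 / t - 1) * psi4 f (v * t) * fZ f (v * t))"
    using set_integrable_psi_star_weight set_integrable_const_weight
    by (subst set_integral_diff) (auto simp del: mult.assoc)
  finally show "(LINT x|P. overshoot v x) - c * (LINT x|P. overshoot v x * snd x) =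
       v * (LINT t:{0<..<1}|lborel. excess v t * weight v t)"
    by (simp add: set_integral_psi_star_weight set_integral_const_weight right_diff_distrib)
qed

end

lemma boundary_in: "1 \<le> l \<Longrightarrow> \<beta> / (l * c) \<in> {0<..\<beta> / c}"
  using beta_pos c_pos by (auto intro!: divide_left_mono)

lemma alpha2_eq:
  "alpha2 f \<beta> l = (LINT t:{0<..<1}|lborel. excess (\<beta> / (l * c)) t * weight (\<beta> / (l * c)) t) /
    (LINT t:{0<..<1}|lborel. weight (\<beta> / (l * c)) t) / c"
proof -
  have arg: "\<beta> * t / (l * c) = \<beta> / (l * c) * t" for t by simp
  have "(LINT t:{0<..<1}|lborel. (1 / t - 1) * (psi_star f (\<beta> / (l * c) * t) - c) *
      psi4 f (\<beta> / (l * c) * t) * fZ f (\<beta> / (l * c) * t)) =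
      (LINT t:{0<..<1}|lborel. excess (\<beta> / (l * c)) t * weight (\<beta> / (l * c)) t)"
    by (rule set_lebesgue_integral_cong) (use excess_weight in auto)
  then show ?thesis unfolding alpha2_def arg weight_def by simp
qed

section \<open>The risk as a quadratic polynomial in \<alpha>\<close>

lemma estimator_measurable [measurable]: "estimator f \<beta> \<alpha> \<in> borel_measurable borel"
  unfolding estimator_def[abs_def] by measurable

text \<open>Both branches of the estimator are c X2 + \<alpha> max(0, \<beta> X1 - c X2). Division
  by \<theta>2 turns the second summand into \<alpha> c V with v = \<beta> / (\<lambda> c).\<close>

lemma risk2_estimator:
  assumes \<theta>: "\<theta> \<in> Theta0"
  shows "risk2 f \<theta> (estimator f \<beta> \<alpha>) =
    (LINT x|P. (c * snd x - 1 + \<alpha> * c * overshoot (\<beta> / (snd \<theta> / fst \<theta> * c)) x)\<^sup>2)"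
proof -
  obtain a b where ab: "\<theta> = (a, b)" "0 < a" "0 < b" using \<theta> by (auto simp: Theta0_def)
  have "(\<lambda>z. (a * fst z, b * snd z)) \<in> borel_measurable borel"
    unfolding borel_prod[symmetric] by measurable
  moreover have "(\<lambda>x. (estimator f \<beta> \<alpha> x / b - 1)\<^sup>2) \<in> borel_measurable borel" by measurable
  ultimately have "risk2 f \<theta> (estimator f \<beta> \<alpha>) =
      (LINT x|P. (estimator f \<beta> \<alpha> (a * fst x, b * snd x) / b - 1)\<^sup>2)"
    using ab unfolding risk2_def by (subst scale_model_eq_distr) (simp_all add: integral_distr)
  also have "\<dots> = (LINT x|P. (c * snd x - 1 + \<alpha> * c * overshoot (\<beta> / (b / a * c)) x)\<^sup>2)"
  proof (intro Bochner_Integration.integral_cong refl arg_cong[where f = "\<lambda>y. y\<^sup>2"])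
    fix x :: "real \<times> real"
    have scale: "c * (\<beta> / (b / a * c) * fst x - snd x) = (\<beta> * (a * fst x) - c * (b * snd x)) / b"
      using ab c_pos by (simp add: field_simps)
    have "c * overshoot (\<beta> / (b / a * c)) x = max 0 ((\<beta> * (a * fst x) - c * (b * snd x)) / b)"
      using c_pos unfolding scale[symmetric] overshoot_def by (auto simp: max_def zero_le_mult_iff mult_le_0_iff)
    moreover have "estimator f \<beta> \<alpha> (a * fst x, b * snd x) / b - 1 =
        c * snd x - 1 + \<alpha> * max 0 ((\<beta> * (a * fst x) - c * (b * snd x)) / b)"
      using ab by (auto simp: estimator_def field_simps max_def)
    ultimately show "estimator f \<beta> \<alpha> (a * fst x, b * snd x) / b - 1 =
        c * snd x - 1 + \<alpha> * c * overshoot (\<beta> / (b / a * c)) x" by simp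
  qed
  finally show ?thesis by (simp add: ab)
qed

text \<open>Completing the square: the vertex is (E[V] - c E[V Z2]) / (c E[V^2]), in which the
  common factor v cancels and leaves \<open>alpha2\<close>. The leading coefficient is c^2 E[V^2] =
  c^2 v W.\<close>

lemma risk2_quadratic:
  assumes \<theta>: "\<theta> \<in> Theta0"
  shows "\<exists>R D. 0 < D \<and> (\<forall>\<alpha>. risk2 f \<theta> (estimator f \<beta> \<alpha>) =
    R + D * (\<alpha> - alpha2 f \<beta> (snd \<theta> / fst \<theta>))\<^sup>2)"
proof -
  define l where "l = snd \<theta> / fst \<theta>"
  define v where "v = \<beta> / (l * c)"
  define W where "W = (LINT t:{0<..<1}|lborel. weight v t)"
  define R0 where "R0 = (LINT x|P. (c * snd x - 1)\<^sup>2)"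
  define a where "a = alpha2 f \<beta> l"
  have "1 \<le> l" using \<theta> by (auto simp: l_def Theta0_def)
  then have v: "v \<in> {0<..\<beta> / c}" unfolding v_def by (rule boundary_in)
  have W: "0 < W" unfolding W_def by (rule set_integral_weight_pos[OF v])
  have N: "(LINT x|P. overshoot v x) - c * (LINT x|P. overshoot v x * snd x) = v * (a * c * W)"
    unfolding set_integral_excess_weight[OF v] a_def
    using W c_pos by (simp add: alpha2_eq W_def v_def)
  have sq: "integrable P (\<lambda>x. (c * snd x - 1)\<^sup>2)"
    unfolding power2_diff power_mult_distrib using moment2 integrable_snd by simp
  have expand: "(c * snd x - 1 + \<alpha> * c * overshoot v x)\<^sup>2 = (c * snd x - 1)\<^sup>2 +
      (2 * \<alpha> * c) * (c * (overshoot v x * snd x) - overshoot v x) + (\<alpha> * c)\<^sup>2 * (overshoot v x)\<^sup>2" for x \<alpha>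
    by (simp add: power2_eq_square algebra_simps)
  have "risk2 f \<theta> (estimator f \<beta> \<alpha>) = (R0 - c\<^sup>2 * v * W * a\<^sup>2) + c\<^sup>2 * v * W * (\<alpha> - a)\<^sup>2" for \<alpha>
  proof -
    have "risk2 f \<theta> (estimator f \<beta> \<alpha>) = R0 + (2 * \<alpha> * c) * (c * (LINT x|P. overshoot v x * snd x) -
        (LINT x|P. overshoot v x)) + (\<alpha> * c)\<^sup>2 * (LINT x|P. (overshoot v x)\<^sup>2)"
      unfolding risk2_estimator[OF \<theta>] l_def[symmetric] v_def[symmetric] expand R0_def
      using sq integrable_overshoot[OF v] integrable_overshoot_snd[OF v] integrable_overshoot_sq[OF v]
      by simp
    also have "c * (LINT x|P. overshoot v x * snd x) - (LINT x|P. overshoot v x) = - (v * (a * c * W))"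
      using N by simp
    also have "(LINT x|P. (overshoot v x)\<^sup>2) = v * W"
      unfolding W_def by (rule set_integral_weight[OF v])
    finally show ?thesis by (simp add: power2_eq_square algebra_simps)
  qed
  moreover have "0 < c\<^sup>2 * v * W" using c_pos v W by simp
  ultimately show ?thesis unfolding a_def l_def by blast
qed

section \<open>Monotonicity of the minimiser\<close>

lemma psi_measurable [measurable]: "psi f r \<in> borel_measurable borel"
  unfolding psi_eq_radial_moment[abs_def] by measurable

lemma fZ_measurable [measurable]: "fZ f \<in> borel_measurable borel"
  unfolding fZ_eq_radial_moment[abs_def] by measurable

text \<open>This is where the monotonicity of \<open>\<psi>\<^sup>*\<close> secures integrability: \<open>\<psi>\<^sup>*(u t)\<close> need not be integrable
  against the weight at \<open>v\<close> in general.\<close>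

lemma set_integrable_cross:
  assumes u: "u \<in> {0<..\<beta> / c}" and v: "v \<in> {0<..\<beta> / c}"
    and le: "\<And>t. t \<in> {0<..<1} \<Longrightarrow> psi_star f (u * t) \<le> psi_star f (v * t)"
  shows "set_integrable lborel {0<..<1} (\<lambda>t. excess u t * weight v t)"
proof (rule set_integrable_bound[OF set_integral_add(1)[OF set_integrable_psi_star_weight[OF v]
      set_integrable_mult_right[OF set_integrable_const_weight[OF v], of c]]])
  show "set_borel_measurable lborel {0<..<1} (\<lambda>t. excess u t * weight v t)"
    unfolding set_borel_measurable_def excess_def weight_def psi_star_def psi3_def psi4_def
    by measurable
  \<comment> \<open>The majorant uses |p - c| \<le> p + c for p \<ge> 0 and then replaces
    \<open>psi_star\<close> at u t by its larger value at v t, which is integrable against the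
    weight at v.\<close>
  have bound: "\<bar>excess u t * weight v t\<bar> \<le> (1 / t - 1) * psi_star f (v * t) * psi4 f (v * t) * fZ f (v * t) +
      c * ((1 / t - 1) * psi4 f (v * t) * fZ f (v * t))" if t: "t \<in> {0<..<1}" for t
  proof -
    have z: "u * t \<in> {0<..<\<beta> / c}" "v * t \<in> {0<..<\<beta> / c}"
      using scaled_in[OF u t] scaled_in[OF v t] .
    have distrib: "(p + c) * (x * a * b) = x * p * a * b + c * (x * a * b)" for p x a b :: real
      by (simp add: algebra_simps)
    let ?g = "(1 / t - 1) * psi4 f (v * t) * fZ f (v * t)"
    have g: "0 \<le> ?g" using t psi4_pos[OF z(2)] fZ_pos[OF z(2)] by simp
    have "\<bar>excess u t * weight v t\<bar> = \<bar>psi_star f (u * t) - c\<bar> * ?g"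
      using g unfolding excess_weight[OF t] by (subst abs_of_nonneg[OF g, symmetric]) (simp add: abs_mult)
    also have "\<dots> \<le> (psi_star f (v * t) + c) * ?g"
      using g le[OF t] psi_star_nonneg[OF z(1)] c_pos by (intro mult_right_mono) auto
    finally show ?thesis unfolding distrib .
  qed
  show "AE t in lborel. t \<in> {0<..<1} \<longrightarrow> norm (excess u t * weight v t) \<le>
      norm ((1 / t - 1) * psi_star f (v * t) * psi4 f (v * t) * fZ f (v * t) +
      c * ((1 / t - 1) * psi4 f (v * t) * fZ f (v * t)))"
    by (intro AE_I2 impI) (unfold real_norm_def, rule order_trans[OF bound abs_ge_self])
qed

text \<open>The two means are compared through the mean of \<open>excess u\<close> under
  \<open>weight v\<close>: Chebyshev's inequality handles the change of weight, and the pointwise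
  order of \<open>psi_star\<close> the change of excess. No order between u and v is assumed, so the
  roles can be exchanged.\<close>

lemma weighted_mean_le:
  assumes u: "u \<in> {0<..\<beta> / c}" and v: "v \<in> {0<..\<beta> / c}"
    and le: "\<And>t. t \<in> {0<..<1} \<Longrightarrow> psi_star f (u * t) \<le> psi_star f (v * t)"
    and similarly_ordered: "\<And>s t. s \<in> {0<..<1} \<Longrightarrow> t \<in> {0<..<1} \<Longrightarrow>
      0 \<le> (excess u s - excess u t) * (weight v s * weight u t - weight v t * weight u s)"
  shows "(LINT t:{0<..<1}|lborel. excess u t * weight u t) / (LINT t:{0<..<1}|lborel. weight u t) \<le>
    (LINT t:{0<..<1}|lborel. excess v t * weight v t) / (LINT t:{0<..<1}|lborel. weight v t)"
proof -
  have cross: "set_integrable lborel {0<..<1} (\<lambda>t. excess u t * weight v t)"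
    using set_integrable_cross[OF u v le] .
  have "excess u t * weight v t \<le> excess v t * weight v t" if "t \<in> {0<..<1}" for t
    using le[OF that] weight_pos[OF v that] that unfolding excess_def
    by (intro mult_right_mono divide_right_mono) auto
  then have "(LINT t:{0<..<1}|lborel. excess u t * weight v t) \<le>
      (LINT t:{0<..<1}|lborel. excess v t * weight v t)"
    using cross set_integrable_excess_weight[OF v] by (intro set_integral_mono) auto
  then have "(LINT t:{0<..<1}|lborel. excess u t * weight v t) * (LINT t:{0<..<1}|lborel. weight u t) \<le>
      (LINT t:{0<..<1}|lborel. excess v t * weight v t) * (LINT t:{0<..<1}|lborel. weight u t)"
    using set_integral_weight_pos[OF u] by (intro mult_right_mono) auto
  with weighted_chebyshev[OF set_integrable_weight[OF u] set_integrable_weight[OF v]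
      set_integrable_excess_weight[OF u] cross similarly_ordered]
  have "(LINT t:{0<..<1}|lborel. excess u t * weight u t) * (LINT t:{0<..<1}|lborel. weight v t) \<le>
      (LINT t:{0<..<1}|lborel. excess v t * weight v t) * (LINT t:{0<..<1}|lborel. weight u t)"
    by (rule order_trans)
  then show ?thesis
    using set_integral_weight_pos[OF u] set_integral_weight_pos[OF v] by (simp add: divide_simps mult.commute)
qed

section \<open>Cross inequalities between weights at two scales\<close>

lemma
  assumes v: "v \<in> {0<..\<beta> / c}" and u: "u \<in> {0<..\<beta> / c}" and vu: "v \<le> u"
    and pos: "\<And>z. z \<in> {0<..<\<beta> / c} \<Longrightarrow> 0 < g z"
    and st: "s \<in> {0<..<1}" "t \<in> {0<..<1}" "s \<le> t"
  shows ratio_increasing_cross: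
      "ratio_increasing_on {0<..<\<beta> / c} g \<Longrightarrow> g (v * s) * g (u * t) \<le> g (v * t) * g (u * s)"
    and ratio_decreasing_cross:
      "ratio_decreasing_on {0<..<\<beta> / c} g \<Longrightarrow> g (v * t) * g (u * s) \<le> g (v * s) * g (u * t)"
proof -
  have in_I: "u * s \<in> {0<..<\<beta> / c}" "u * t \<in> {0<..<\<beta> / c}"
    using scaled_in[OF u st(1)] scaled_in[OF u st(2)] .
  have us_ut: "u * s \<le> u * t" using u st by auto
  \<comment> \<open>The ratio hypothesis is applied with \<theta> = v / u at the points u s \<le> u
    t. The case v = u, where \<theta> would be 1, is treated separately and is an equality.\<close>
  have v_eq: "v * r = v / u * (u * r)" for r using u by simp
  show "g (v * s) * g (u * t) \<le> g (v * t) * g (u * s)" if inc: "ratio_increasing_on {0<..<\<beta> / c} g"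
  proof (cases "v = u")
    case False
    then have "v / u \<in> {0<..<1}" using v u vu by simp
    with inc have "g (v * s) / g (u * s) \<le> g (v * t) / g (u * t)"
      using in_I us_ut unfolding ratio_increasing_on_def v_eq[of s] v_eq[of t]
      by (blast dest: mono_onD)
    then show ?thesis using pos[OF in_I(1)] pos[OF in_I(2)] by (simp add: field_simps)
  qed (simp add: mult.commute)
  show "g (v * t) * g (u * s) \<le> g (v * s) * g (u * t)" if dec: "ratio_decreasing_on {0<..<\<beta> / c} g"
  proof (cases "v = u")
    case False
    then have "v / u \<in> {0<..<1}" using v u vu by simp
    with dec have "g (v * t) / g (u * t) \<le> g (v * s) / g (u * s)"
      using in_I us_ut unfolding ratio_decreasing_on_def v_eq[of s] v_eq[of t]
      by (blast dest: monotone_onD)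
    then show ?thesis using pos[OF in_I(1)] pos[OF in_I(2)] by (simp add: field_simps)
  qed (simp add: mult.commute)
qed

text \<open>The factors (1/s - 1)^2 and (1/t - 1)^2 occur on both sides; the cross inequalities for
  \<open>psi4\<close> and \<open>fZ\<close> then multiply because all their factors are
  nonnegative.\<close>

lemma
  assumes v: "v \<in> {0<..\<beta> / c}" and u: "u \<in> {0<..\<beta> / c}" and vu: "v \<le> u"
    and st: "s \<in> {0<..<1}" "t \<in> {0<..<1}" "s \<le> t"
  shows weight_increasing_cross:
      "ratio_increasing_on {0<..<\<beta> / c} (psi4 f) \<Longrightarrow> ratio_increasing_on {0<..<\<beta> / c} (fZ f) \<Longrightarrow>
        weight v s * weight u t \<le> weight v t * weight u s"
    and weight_decreasing_cross:
      "ratio_decreasing_on {0<..<\<beta> / c} (psi4 f) \<Longrightarrow> ratio_decreasing_on {0<..<\<beta> / c} (fZ f) \<Longrightarrow>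
        weight v t * weight u s \<le> weight v s * weight u t"
proof -
  note cross_inc = ratio_increasing_cross[OF v u vu _ st] and cross_dec = ratio_decreasing_cross[OF v u vu _ st]
  have pos: "0 \<le> psi4 f (v * r)" "0 \<le> psi4 f (u * r)" "0 \<le> fZ f (v * r)" "0 \<le> fZ f (u * r)"
    if "r \<in> {0<..<1}" for r
    using psi4_pos[OF scaled_in[OF v that]] psi4_pos[OF scaled_in[OF u that]]
      fZ_pos[OF scaled_in[OF v that]] fZ_pos[OF scaled_in[OF u that]] by simp_all
  have eq: "weight v x * weight u y = ((1 / x - 1)\<^sup>2 * (1 / y - 1)\<^sup>2) *
      ((psi4 f (v * x) * psi4 f (u * y)) * (fZ f (v * x) * fZ f (u * y)))" for x y
    by (simp add: weight_def)
  show "weight v s * weight u t \<le> weight v t * weight u s"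
    if "ratio_increasing_on {0<..<\<beta> / c} (psi4 f)" "ratio_increasing_on {0<..<\<beta> / c} (fZ f)"
    unfolding eq mult.commute[of "(1 / t - 1)\<^sup>2"]
    by (rule mult_left_mono[OF mult_mono[OF cross_inc[OF psi4_pos that(1)] cross_inc[OF fZ_pos that(2)]]])
      (use pos st in auto)
  show "weight v t * weight u s \<le> weight v s * weight u t"
    if "ratio_decreasing_on {0<..<\<beta> / c} (psi4 f)" "ratio_decreasing_on {0<..<\<beta> / c} (fZ f)"
    unfolding eq mult.commute[of "(1 / t - 1)\<^sup>2"]
    by (rule mult_left_mono[OF mult_mono[OF cross_dec[OF psi4_pos that(1)] cross_dec[OF fZ_pos that(2)]]])
      (use pos st in auto)
qed

lemma excess_eq_k2: "excess (\<beta> / (l * c)) z = k2 f \<beta> z l"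
  by (simp add: excess_def k2_def)

text \<open>A larger \<lambda> means a smaller scale, v \<le> u. In the first case \<open>k2\<close>
  at l and the quotient of the weight at v by the weight at u both increase, in the second both
  decrease; either way they are similarly ordered.\<close>

lemma alpha2_mono:
  assumes psi: "antimono_on {0<..<\<beta> / c} (psi_star f)"
    and cases: "(ratio_increasing_on {0<..<\<beta> / c} (psi4 f) \<and> ratio_increasing_on {0<..<\<beta> / c} (fZ f) \<and>
        (\<forall>l\<ge>1. mono_on {0<..<1} (\<lambda>z. k2 f \<beta> z l))) \<or>
      (ratio_decreasing_on {0<..<\<beta> / c} (psi4 f) \<and> ratio_decreasing_on {0<..<\<beta> / c} (fZ f) \<and>
        (\<forall>l\<ge>1. antimono_on {0<..<1} (\<lambda>z. k2 f \<beta> z l)))"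
    and l: "1 \<le> l" "l \<le> l'"
  shows "alpha2 f \<beta> l \<le> alpha2 f \<beta> l'"
proof -
  define u where "u = \<beta> / (l * c)"
  define v where "v = \<beta> / (l' * c)"
  have u: "u \<in> {0<..\<beta> / c}" and v: "v \<in> {0<..\<beta> / c}"
    using boundary_in l by (auto simp: u_def v_def)
  have vu: "v \<le> u" unfolding u_def v_def
    using l beta_pos c_pos by (intro divide_left_mono mult_right_mono) auto
  have ordered: "(excess u s \<le> excess u t \<and> weight v s * weight u t \<le> weight v t * weight u s) \<or>
      (excess u t \<le> excess u s \<and> weight v t * weight u s \<le> weight v s * weight u t)"
    if "s \<in> {0<..<1}" "t \<in> {0<..<1}" "s \<le> t" for s t
    using cases
  proof (elim disjE conjE)
    assume *: "ratio_increasing_on {0<..<\<beta> / c} (psi4 f)" "ratio_increasing_on {0<..<\<beta> / c} (fZ f)"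
      and k: "\<forall>l\<ge>1. mono_on {0<..<1} (\<lambda>z. k2 f \<beta> z l)"
    have "excess u s \<le> excess u t"
      unfolding u_def excess_eq_k2 by (rule mono_onD[OF k[rule_format, OF l(1)] that])
    with weight_increasing_cross[OF v u vu that *] show ?thesis by simp
  next
    assume *: "ratio_decreasing_on {0<..<\<beta> / c} (psi4 f)" "ratio_decreasing_on {0<..<\<beta> / c} (fZ f)"
      and k: "\<forall>l\<ge>1. antimono_on {0<..<1} (\<lambda>z. k2 f \<beta> z l)"
    have "excess u t \<le> excess u s"
      unfolding u_def excess_eq_k2 by (rule monotone_onD[OF k[rule_format, OF l(1)] that])
    with weight_decreasing_cross[OF v u vu that *] show ?thesis by simp
  qed
  have "psi_star f (u * t) \<le> psi_star f (v * t)" if t: "t \<in> {0<..<1}" for t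
    using monotone_onD[OF psi scaled_in[OF v t] scaled_in[OF u t]] vu t by auto
  \<comment> \<open>Exchanging s and t flips the sign of both factors, so the case s \<le> t covers
    all pairs.\<close>
  moreover have "0 \<le> (excess u s - excess u t) * (weight v s * weight u t - weight v t * weight u s)"
    if "s \<in> {0<..<1}" "t \<in> {0<..<1}" for s t
    using ordered[OF that] ordered[OF that(2) that(1)] linear[of s t] unfolding zero_le_mult_iff by auto
  ultimately have "(LINT t:{0<..<1}|lborel. excess u t * weight u t) / (LINT t:{0<..<1}|lborel. weight u t) \<le>
    (LINT t:{0<..<1}|lborel. excess v t * weight v t) / (LINT t:{0<..<1}|lborel. weight v t)"
    by (rule weighted_mean_le[OF u v])
  then show ?thesis
    unfolding alpha2_eq u_def[symmetric] v_def[symmetric] using c_pos by (intro divide_right_mono) auto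
qed

text \<open>Here the intermediate mean pairs the excess at the larger \<lambda> with the weight at
  the smaller one. The inverse weight quotient is the relevant one, which is why the monotonicity
  demanded of \<open>k2\<close> is opposite to that in \<open>alpha2_mono\<close>.\<close>

lemma alpha2_antimono:
  assumes psi: "mono_on {0<..<\<beta> / c} (psi_star f)"
    and cases: "(ratio_increasing_on {0<..<\<beta> / c} (psi4 f) \<and> ratio_increasing_on {0<..<\<beta> / c} (fZ f) \<and>
        (\<forall>l\<ge>1. antimono_on {0<..<1} (\<lambda>z. k2 f \<beta> z l))) \<or>
      (ratio_decreasing_on {0<..<\<beta> / c} (psi4 f) \<and> ratio_decreasing_on {0<..<\<beta> / c} (fZ f) \<and>
        (\<forall>l\<ge>1. mono_on {0<..<1} (\<lambda>z. k2 f \<beta> z l)))"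
    and l: "1 \<le> l" "l \<le> l'"
  shows "alpha2 f \<beta> l' \<le> alpha2 f \<beta> l"
proof -
  define u where "u = \<beta> / (l * c)"
  define v where "v = \<beta> / (l' * c)"
  have l': "1 \<le> l'" using l by simp
  have u: "u \<in> {0<..\<beta> / c}" and v: "v \<in> {0<..\<beta> / c}"
    using boundary_in l by (auto simp: u_def v_def)
  have vu: "v \<le> u" unfolding u_def v_def
    using l beta_pos c_pos by (intro divide_left_mono mult_right_mono) auto
  have ordered: "(excess v t \<le> excess v s \<and> weight v s * weight u t \<le> weight v t * weight u s) \<or>
      (excess v s \<le> excess v t \<and> weight v t * weight u s \<le> weight v s * weight u t)"
    if "s \<in> {0<..<1}" "t \<in> {0<..<1}" "s \<le> t" for s t
    using cases
  proof (elim disjE conjE)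
    assume *: "ratio_increasing_on {0<..<\<beta> / c} (psi4 f)" "ratio_increasing_on {0<..<\<beta> / c} (fZ f)"
      and k: "\<forall>l\<ge>1. antimono_on {0<..<1} (\<lambda>z. k2 f \<beta> z l)"
    have "excess v t \<le> excess v s"
      unfolding v_def excess_eq_k2 by (rule monotone_onD[OF k[rule_format, OF l'] that])
    with weight_increasing_cross[OF v u vu that *] show ?thesis by simp
  next
    assume *: "ratio_decreasing_on {0<..<\<beta> / c} (psi4 f)" "ratio_decreasing_on {0<..<\<beta> / c} (fZ f)"
      and k: "\<forall>l\<ge>1. mono_on {0<..<1} (\<lambda>z. k2 f \<beta> z l)"
    have "excess v s \<le> excess v t"
      unfolding v_def excess_eq_k2 by (rule mono_onD[OF k[rule_format, OF l'] that])
    with weight_decreasing_cross[OF v u vu that *] show ?thesis by simp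
  qed
  have "psi_star f (v * t) \<le> psi_star f (u * t)" if t: "t \<in> {0<..<1}" for t
    using mono_onD[OF psi scaled_in[OF v t] scaled_in[OF u t]] vu t by auto
  moreover have "0 \<le> (excess v s - excess v t) * (weight u s * weight v t - weight u t * weight v s)"
    if "s \<in> {0<..<1}" "t \<in> {0<..<1}" for s t
    using ordered[OF that] ordered[OF that(2) that(1)] linear[of s t]
    unfolding zero_le_mult_iff by (auto simp: mult.commute)
  ultimately have "(LINT t:{0<..<1}|lborel. excess v t * weight v t) / (LINT t:{0<..<1}|lborel. weight v t) \<le>
    (LINT t:{0<..<1}|lborel. excess u t * weight u t) / (LINT t:{0<..<1}|lborel. weight u t)"
    by (rule weighted_mean_le[OF v u])
  then show ?thesis
    unfolding alpha2_eq u_def[symmetric] v_def[symmetric] using c_pos by (intro divide_right_mono) auto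
qed

end

theorem theorem4p2p1:
  fixes f :: "real \<times> real \<Rightarrow> real" and \<beta> :: real
  assumes f_measurable: "f \<in> borel_measurable borel"
    and f_nonneg: "\<And>x. 0 \<le> f x"
    and f_prob: "prob_space (density lborel (\<lambda>z. ennreal (f z)))"
    and f_support: "\<And>x. x \<notin> {0<..} \<times> {0<..} \<Longrightarrow> f x = 0"
    and moment1: "integrable (density lborel (\<lambda>z. ennreal (f z))) (\<lambda>z. (fst z)\<^sup>2)"
    and moment2: "integrable (density lborel (\<lambda>z. ennreal (f z))) (\<lambda>z. (snd z)\<^sup>2)"
    and beta_pos: "0 < \<beta>"
    and well_defined: "\<And>z r. z \<in> {0<..<\<beta> / c02 f} \<Longrightarrow> r \<in> {0, 1, 2::nat} \<Longrightarrow>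
           set_integrable lborel {0<..} (\<lambda>s. s ^ (r + 1) * f (s, s * z))"
    and fZ_pos: "\<And>z. z \<in> {0<..<\<beta> / c02 f} \<Longrightarrow> 0 < fZ f z"
  shows
    "(antimono_on {0<..<\<beta> / c02 f} (psi_star f) \<and>
      ((ratio_increasing_on {0<..<\<beta> / c02 f} (psi4 f) \<and>
        ratio_increasing_on {0<..<\<beta> / c02 f} (fZ f) \<and>
        (\<forall>l\<ge>1. mono_on {0<..<1} (\<lambda>z. k2 f \<beta> z l))) \<or>
       (ratio_decreasing_on {0<..<\<beta> / c02 f} (psi4 f) \<and>
        ratio_decreasing_on {0<..<\<beta> / c02 f} (fZ f) \<and>
        (\<forall>l\<ge>1. antimono_on {0<..<1} (\<lambda>z. k2 f \<beta> z l))))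
      \<longrightarrow>
      ((\<lambda>l. ereal (alpha2 f \<beta> l)) \<longlongrightarrow> alpha2_inf f \<beta>) at_top \<and>
      {d. admissible_within f (D2 f \<beta>) d} =
        {estimator f \<beta> \<alpha> |\<alpha>. ereal (alpha2 f \<beta> 1) \<le> ereal \<alpha> \<and> ereal \<alpha> \<le> alpha2_inf f \<beta>} \<and>
      (\<forall>a b. (a < b \<and> b \<le> alpha2 f \<beta> 1) \<or> (alpha2_inf f \<beta> \<le> ereal b \<and> b < a) \<longrightarrow>
         dominates f (estimator f \<beta> b) (estimator f \<beta> a)))
     \<and>
     (mono_on {0<..<\<beta> / c02 f} (psi_star f) \<and>
      ((ratio_increasing_on {0<..<\<beta> / c02 f} (psi4 f) \<and>
        ratio_increasing_on {0<..<\<beta> / c02 f} (fZ f) \<and>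
        (\<forall>l\<ge>1. antimono_on {0<..<1} (\<lambda>z. k2 f \<beta> z l))) \<or>
       (ratio_decreasing_on {0<..<\<beta> / c02 f} (psi4 f) \<and>
        ratio_decreasing_on {0<..<\<beta> / c02 f} (fZ f) \<and>
        (\<forall>l\<ge>1. mono_on {0<..<1} (\<lambda>z. k2 f \<beta> z l))))
      \<longrightarrow>
      ((\<lambda>l. ereal (alpha2 f \<beta> l)) \<longlongrightarrow> alpha2_inf f \<beta>) at_top \<and>
      {d. admissible_within f (D2 f \<beta>) d} =
        {estimator f \<beta> \<alpha> |\<alpha>. alpha2_inf f \<beta> \<le> ereal \<alpha> \<and> ereal \<alpha> \<le> ereal (alpha2 f \<beta> 1)} \<and>
      (\<forall>a b. (a < b \<and> ereal b \<le> alpha2_inf f \<beta>) \<or> (alpha2 f \<beta> 1 \<le> b \<and> b < a) \<longrightarrow>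
         dominates f (estimator f \<beta> b) (estimator f \<beta> a)))"
proof -
  interpret scale_density f \<beta>
    using assms by (rule scale_density.intro)
  \<comment> \<open>Once monotonicity is available, these facts show that the definite description
    in \<open>alpha2_inf\<close> denotes an actual limit.\<close>
  note lim = nondecreasing_tendsto_Lim[of 1 "\<lambda>l. ereal (alpha2 f \<beta> l)", folded alpha2_inf_def]
  note lim' = nonincreasing_tendsto_Lim[of 1 "\<lambda>l. ereal (alpha2 f \<beta> l)", folded alpha2_inf_def]
  show ?thesis
    unfolding D2_def
  proof (rule conjI; intro impI; elim conjE)
    assume hyp: "antimono_on {0<..<\<beta> / c02 f} (psi_star f)"
      "(ratio_increasing_on {0<..<\<beta> / c02 f} (psi4 f) \<and>
        ratio_increasing_on {0<..<\<beta> / c02 f} (fZ f) \<and>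
        (\<forall>l\<ge>1. mono_on {0<..<1} (\<lambda>z. k2 f \<beta> z l))) \<or>
       (ratio_decreasing_on {0<..<\<beta> / c02 f} (psi4 f) \<and>
        ratio_decreasing_on {0<..<\<beta> / c02 f} (fZ f) \<and>
        (\<forall>l\<ge>1. antimono_on {0<..<1} (\<lambda>z. k2 f \<beta> z l)))"
    note mono = alpha2_mono[OF hyp]
    have L: "((\<lambda>l. ereal (alpha2 f \<beta> l)) \<longlongrightarrow> alpha2_inf f \<beta>) at_top"
      using mono by (intro lim) simp
    show "((\<lambda>l. ereal (alpha2 f \<beta> l)) \<longlongrightarrow> alpha2_inf f \<beta>) at_top \<and>
      {d. admissible_within f (range (estimator f \<beta>)) d} =
        {estimator f \<beta> \<alpha> |\<alpha>. ereal (alpha2 f \<beta> 1) \<le> ereal \<alpha> \<and> ereal \<alpha> \<le> alpha2_inf f \<beta>} \<and>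
      (\<forall>a b. (a < b \<and> b \<le> alpha2 f \<beta> 1) \<or> (alpha2_inf f \<beta> \<le> ereal b \<and> b < a) \<longrightarrow>
         dominates f (estimator f \<beta> b) (estimator f \<beta> a))"
      by (intro conjI allI impI L admissible_nondecreasing[OF risk2_quadratic mono L]
          dominates_nondecreasing[OF risk2_quadratic mono L])
  next
    assume hyp: "mono_on {0<..<\<beta> / c02 f} (psi_star f)"
      "(ratio_increasing_on {0<..<\<beta> / c02 f} (psi4 f) \<and>
        ratio_increasing_on {0<..<\<beta> / c02 f} (fZ f) \<and>
        (\<forall>l\<ge>1. antimono_on {0<..<1} (\<lambda>z. k2 f \<beta> z l))) \<or>
       (ratio_decreasing_on {0<..<\<beta> / c02 f} (psi4 f) \<and>
        ratio_decreasing_on {0<..<\<beta> / c02 f} (fZ f) \<and>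
        (\<forall>l\<ge>1. mono_on {0<..<1} (\<lambda>z. k2 f \<beta> z l)))"
    note anti = alpha2_antimono[OF hyp]
    have L: "((\<lambda>l. ereal (alpha2 f \<beta> l)) \<longlongrightarrow> alpha2_inf f \<beta>) at_top"
      using anti by (intro lim') simp
    show "((\<lambda>l. ereal (alpha2 f \<beta> l)) \<longlongrightarrow> alpha2_inf f \<beta>) at_top \<and>
      {d. admissible_within f (range (estimator f \<beta>)) d} =
        {estimator f \<beta> \<alpha> |\<alpha>. alpha2_inf f \<beta> \<le> ereal \<alpha> \<and> ereal \<alpha> \<le> ereal (alpha2 f \<beta> 1)} \<and>
      (\<forall>a b. (a < b \<and> ereal b \<le> alpha2_inf f \<beta>) \<or> (alpha2 f \<beta> 1 \<le> b \<and> b < a) \<longrightarrow>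
         dominates f (estimator f \<beta> b) (estimator f \<beta> a))"
      by (intro conjI allI impI L admissible_nonincreasing[OF risk2_quadratic anti L]
          dominates_nonincreasing[OF risk2_quadratic anti L])
  qed
qed

end
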